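(* The Schwarz genus of the covering $E_{\mathrm{flex}}\to B_{\mathrm{flex}}$, $(F,p_1,\dots,p_{24})\mapsto F$, satisfies $g(E_{\mathrm{flex}}\to B_{\mathrm{flex}})\ge 9$.
   Context: Let $B_{\mathrm{flex}}$ be the space of homogeneous quartic polynomials $F(x,y,z)$ over $\mathbb{C}$, modulo scaling by $\mathbb{C}^\times$, such that $F=0$ is a quartic curve in $\mathbb{CP}^2$ with exactly 24 distinct inflection points (nonsingular points at which the tangent line meets the curve with multiplicity at least 3); it is an open submanifold of $\mathbb{CP}^{14}$. Let $E_{\mathrm{flex}}$ be the space of tuples $(F,p_1,\dots,p_{24})$ with $F\in B_{\mathrm{flex}}$ and $p_1,\dots,p_{24}$ the 24 distinct inflection points of the curve $F=0$ in some order (topologized as a subspace of $B_{\mathrm{flex}}\times(\mathbb{CP}^2)^{24}$). The projection $E_{\mathrm{flex}}\to B_{\mathrm{flex}}$ is a normal $S_{24}$-cover (principal $S_{24}$-bundle). The Schwarz genus $g(E\to B)$ of a covering $E\to B$ is the minimum size of an open cover of $B$ such that the covering map $E\to B$ has a continuous section over each open set of the cover. *)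

theory Defs
  imports "HOL-Analysis.Analysis" "HOL-Computational_Algebra.Polynomial"
begin

section \<open>Complex projective spaces\<close>

text \<open>A point \<open>[v]\<close> of a projective space is the orbit of \<open>v \<noteq> 0\<close> under scaling by nonzero
  complex numbers.\<close>

definition proj_class :: "complex ^ 'n \<Rightarrow> (complex ^ 'n) set" where
  "proj_class v = {c *s v | c. c \<noteq> 0}"

definition proj_space :: "(complex ^ 'n) set topology" where
  "proj_space =
     topology (\<lambda>U. U \<subseteq> proj_class ` (- {0}) \<and> open {v. v \<noteq> 0 \<and> proj_class v \<in> U})"

lemma openin_proj_space:
  "openin proj_space U \<longleftrightarrow>
     U \<subseteq> proj_class ` (- {0}) \<and> open {v :: complex ^ 'n. v \<noteq> 0 \<and> proj_class v \<in> U}"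
proof -
  have "istopology (\<lambda>U. U \<subseteq> proj_class ` (- {0}) \<and>
                        open {v :: complex ^ 'n. v \<noteq> 0 \<and> proj_class v \<in> U})"
    unfolding istopology_def
  proof (intro conjI allI impI)
    fix S T :: "(complex ^ 'n) set set"
    assume S: "S \<subseteq> proj_class ` (- {0}) \<and> open {v. v \<noteq> 0 \<and> proj_class v \<in> S}"
      and T: "T \<subseteq> proj_class ` (- {0}) \<and> open {v. v \<noteq> 0 \<and> proj_class v \<in> T}"
    show "S \<inter> T \<subseteq> proj_class ` (- {0})"
      using S by blast
    have "open ({v. v \<noteq> 0 \<and> proj_class v \<in> S} \<inter> {v. v \<noteq> 0 \<and> proj_class v \<in> T})"
      using S T by (intro open_Int) blast+
    moreover have "{v. v \<noteq> 0 \<and> proj_class v \<in> S \<inter> T} =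
          {v. v \<noteq> 0 \<and> proj_class v \<in> S} \<inter> {v. v \<noteq> 0 \<and> proj_class v \<in> T}"
      by blast
    ultimately show "open {v. v \<noteq> 0 \<and> proj_class v \<in> S \<inter> T}"
      by (simp only:)
  next
    fix K :: "(complex ^ 'n) set set set"
    assume K: "\<forall>S\<in>K. S \<subseteq> proj_class ` (- {0}) \<and> open {v. v \<noteq> 0 \<and> proj_class v \<in> S}"
    show "\<Union>K \<subseteq> proj_class ` (- {0})"
      using K by blast
    have "open (\<Union>S\<in>K. {v. v \<noteq> 0 \<and> proj_class v \<in> S})"
      using K by (intro open_UN) blast
    moreover have "{v. v \<noteq> 0 \<and> proj_class v \<in> \<Union>K} = (\<Union>S\<in>K. {v. v \<noteq> 0 \<and> proj_class v \<in> S})"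
      by blast
    ultimately show "open {v. v \<noteq> 0 \<and> proj_class v \<in> \<Union>K}"
      by (simp only:)
  qed
  then show ?thesis
    by (simp add: proj_space_def topology_inverse')
qed

lemma topspace_proj_space:
  "topspace proj_space = (proj_class ` (- {0}) :: (complex ^ 'n) set set)"
proof
  show "topspace proj_space \<subseteq> (proj_class ` (- {0}) :: (complex ^ 'n) set set)"
    unfolding topspace_def using openin_proj_space by blast
  have "{v :: complex ^ 'n. v \<noteq> 0 \<and> proj_class v \<in> proj_class ` (- {0})} = - {0}"
    by auto
  then have "openin proj_space (proj_class ` (- {0}) :: (complex ^ 'n) set set)"
    by (simp add: openin_proj_space open_Compl)
  then show "(proj_class ` (- {0}) :: (complex ^ 'n) set set) \<subseteq> topspace proj_space"
    by (rule openin_subset)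
qed

lemma quotient_map_proj_class:
  "quotient_map (top_of_set (- {0 :: complex ^ 'n})) proj_space proj_class"
proof -
  have "openin (top_of_set (- {0 :: complex ^ 'n})) {x \<in> - {0}. proj_class x \<in> U}
        \<longleftrightarrow> open {v. v \<noteq> 0 \<and> proj_class v \<in> U}" for U
    by (subst openin_open_eq) (auto simp: open_Compl)
  then show ?thesis
    by (auto simp: quotient_map_def topspace_proj_space openin_proj_space)
qed


section \<open>Ternary quartic forms\<close>

typedef quartic_exponent = "{a :: 3 \<Rightarrow> nat. (\<Sum>i\<in>UNIV. a i) = 4}"
  morphisms exponent Abs_quartic_exponent
proof
  show "(\<lambda>i. if i = 1 then 4 else 0) \<in> {a :: 3 \<Rightarrow> nat. (\<Sum>i\<in>UNIV. a i) = 4}"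
    by simp
qed

lemma quartic_exponents_subset:
  "{a :: 3 \<Rightarrow> nat. (\<Sum>i\<in>UNIV. a i) = 4} \<subseteq> PiE UNIV (\<lambda>_. {..4})"
proof
  fix a :: "3 \<Rightarrow> nat"
  assume "a \<in> {a. (\<Sum>i\<in>UNIV. a i) = 4}"
  then have s: "(\<Sum>i\<in>UNIV. a i) = 4" by simp
  have "a i \<le> 4" for i
    using member_le_sum[of i UNIV a] s by simp
  then show "a \<in> PiE UNIV (\<lambda>_. {..4})" by auto
qed

instance quartic_exponent :: finite
proof
  have "finite (PiE (UNIV :: 3 set) (\<lambda>_. {..4 :: nat}))"
    by (rule finite_PiE) auto
  then have "finite {a :: 3 \<Rightarrow> nat. (\<Sum>i\<in>UNIV. a i) = 4}"
    using quartic_exponents_subset finite_subset by blast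
  then show "finite (UNIV :: quartic_exponent set)"
    using type_definition.univ[OF type_definition_quartic_exponent] by (metis finite_imageI)
qed

lemma card_quartic_exponent: "CARD(quartic_exponent) = 15"
proof -
  have "bij_betw (\<lambda>a. (a 1, a 2)) {a :: 3 \<Rightarrow> nat. (\<Sum>i\<in>UNIV. a i) = 4} (SIGMA p:{..4}. {..4 - p})"
  proof (rule bij_betwI[where g = "\<lambda>(p, q) i. if i = 1 then p else if i = 2 then q else 4 - p - q"])
  qed (auto simp: sum_3 fun_eq_iff forall_3)
  then have "card {a :: 3 \<Rightarrow> nat. (\<Sum>i\<in>UNIV. a i) = 4} = (\<Sum>p\<le>4. card {..4 - p :: nat})"
    by (simp add: bij_betw_same_card)
  also have "\<dots> = 15"
    by (simp add: numeral_eq_Suc)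
  finally show ?thesis
    using type_definition.card[OF type_definition_quartic_exponent] by simp
qed

text \<open>A quartic form is its vector of coefficients.\<close>

type_synonym quartic = "complex ^ quartic_exponent"

definition quartic_eval :: "quartic \<Rightarrow> complex ^ 3 \<Rightarrow> complex" where
  "quartic_eval F x = (\<Sum>m\<in>UNIV. F $ m * (\<Prod>i\<in>UNIV. x $ i ^ exponent m i))"

definition partial_deriv :: "quartic \<Rightarrow> 3 \<Rightarrow> complex ^ 3 \<Rightarrow> complex" where
  "partial_deriv F i x = deriv (\<lambda>t. quartic_eval F (x + axis i t)) 0"

text \<open>The restriction of \<open>F\<close> to the line through \<open>[v]\<close> and \<open>[w]\<close>, in the affine coordinate
  \<open>t \<mapsto> [v + t w]\<close> centred at \<open>[v]\<close>.\<close>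

definition line_poly :: "quartic \<Rightarrow> complex ^ 3 \<Rightarrow> complex ^ 3 \<Rightarrow> complex poly" where
  "line_poly F v w = (\<Sum>m\<in>UNIV. smult (F $ m) (\<Prod>i\<in>UNIV. [:v $ i, w $ i:] ^ exponent m i))"

lemma poly_line_poly: "poly (line_poly F v w) t = quartic_eval F (v + t *s w)"
  by (simp add: line_poly_def quartic_eval_def poly_sum poly_prod)

text \<open>The intersection multiplicity of the curve with that line at \<open>[v]\<close>; it is infinite if the
  line is contained in the curve.\<close>

definition intersection_mult :: "quartic \<Rightarrow> complex ^ 3 \<Rightarrow> complex ^ 3 \<Rightarrow> enat" where
  "intersection_mult F v w =
     (if line_poly F v w = 0 then \<infinity> else enat (order 0 (line_poly F v w)))"

text \<open>\<open>v\<close> is nonzero and \<open>[v]\<close> is a nonsingular point of the curve whose tangent line, spanned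
  by \<open>[v]\<close> and any further point \<open>[w]\<close> on it, has contact of order at least 3 with the curve.\<close>

definition is_inflection :: "quartic \<Rightarrow> complex ^ 3 \<Rightarrow> bool" where
  "is_inflection F v \<longleftrightarrow>
     v \<noteq> 0 \<and> quartic_eval F v = 0 \<and> (\<exists>i. partial_deriv F i v \<noteq> 0) \<and>
     (\<exists>w. w \<noteq> 0 \<and> proj_class w \<noteq> proj_class v \<and>
          (\<Sum>i\<in>UNIV. partial_deriv F i v * w $ i) = 0 \<and>
          intersection_mult F v w \<ge> 3)"

definition inflection_points :: "quartic \<Rightarrow> (complex ^ 3) set set" where
  "inflection_points F = proj_class ` {v. is_inflection F v}"

lemma inflection_points_scale:
  assumes "c \<noteq> 0"
  shows "inflection_points (c *s F) = inflection_points F"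
proof -
  have e: "quartic_eval (c *s F) x = c * quartic_eval F x" for x
    by (simp add: quartic_eval_def sum_distrib_left mult.assoc)
  have "quartic_eval F (x + axis i t) = poly (line_poly F x (axis i 1)) t" for i x t
  proof -
    have "t *s axis i 1 = (axis i t :: complex ^ 3)"
      by (simp add: vec_eq_iff axis_def)
    then show ?thesis
      by (simp add: poly_line_poly)
  qed
  then have differentiable: "(\<lambda>t. quartic_eval F (x + axis i t)) field_differentiable at 0" for i x
    by (simp add: field_differentiable_def) (use poly_DERIV in blast)
  have d: "partial_deriv (c *s F) i x = c * partial_deriv F i x" for i x
    unfolding partial_deriv_def e using differentiable by (rule deriv_cmult)
  have l: "line_poly (c *s F) v w = smult c (line_poly F v w)" for v w
    by (simp add: line_poly_def poly_eq_iff coeff_sum sum_distrib_left mult.assoc)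
  have "intersection_mult (c *s F) v w = intersection_mult F v w" for v w
    using assms by (simp add: intersection_mult_def l order_smult)
  then show ?thesis
    using assms
    by (simp add: inflection_points_def is_inflection_def e d mult.assoc
        flip: sum_distrib_left)
qed


section \<open>The covering of quartics by orderings of their inflection points\<close>

definition B_flex :: "quartic set set" where
  "B_flex = {proj_class F | F. F \<noteq> 0 \<and> card (inflection_points F) = 24}"

definition E_flex :: "(quartic set \<times> (nat \<Rightarrow> (complex ^ 3) set)) set" where
  "E_flex = {(proj_class F, p) | F p.
     F \<noteq> 0 \<and> card (inflection_points F) = 24 \<and>
     p \<in> extensional {..<24} \<and> bij_betw p {..<24} (inflection_points F)}"

definition B_flex_top :: "quartic set topology" where
  "B_flex_top = subtopology proj_space B_flex"

definition E_flex_top :: "(quartic set \<times> (nat \<Rightarrow> (complex ^ 3) set)) topology" where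
  "E_flex_top =
     subtopology (prod_topology B_flex_top (product_topology (\<lambda>_. proj_space) {..<24})) E_flex"


section \<open>Schwarz genus\<close>

text \<open>The genus is \<open>\<infinity>\<close> if there is no finite open cover with sections.\<close>

definition schwarz_genus :: "'e topology \<Rightarrow> 'b topology \<Rightarrow> ('e \<Rightarrow> 'b) \<Rightarrow> enat" where
  "schwarz_genus E B \<pi> = Inf {enat (card \<U>) | \<U>.
     finite \<U> \<and> (\<forall>U\<in>\<U>. openin B U) \<and> \<Union>\<U> = topspace B \<and>
     (\<forall>U\<in>\<U>. \<exists>s. continuous_map (subtopology B U) E s \<and> (\<forall>b\<in>U. \<pi> (s b) = b))}"

end

theory Submission
  imports Defs "HOL-Library.Z2"
begin

text \<open>The group \<open>(\<int>/2)\<^sup>2\<close> of diagonal sign matrices in \<open>SU(3)\<close> preserves an even quartic with 24 flexes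
  and acts freely on these, so over the orbit map of this quartic a section of the covering selects
  signs on \<open>SU(3)\<close> that the group flips by its characters \<open>\<alpha>\<close>, \<open>\<beta>\<close>.  Eight sections over a cover
  would make a product of eight such classes vanish on \<open>SU(3)/(\<int>/2)\<^sup>2\<close>, but \<open>\<alpha>\<^sup>5 \<beta>\<^sup>3\<close> does not vanish
  there.  To see this, \<open>SU(3)\<close> is the set of pairs \<open>(u, v)\<close> of orthogonal vectors on \<open>S\<^sup>5 \<times> S\<^sup>5\<close>, the zero
  set of the Hermitian product, whose real and imaginary part are both of type \<open>\<alpha> + \<beta>\<close>; and
  \<open>\<alpha>\<^sup>5 \<beta>\<^sup>3 (\<alpha> + \<beta>)\<^sup>2 = \<alpha>\<^sup>5 \<beta>\<^sup>5\<close> is the top class of \<open>\<real>P\<^sup>5 \<times> \<real>P\<^sup>5\<close>.  This Borsuk-Ulam statement for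
  products of spheres is proved by evaluating cup products on cubical grids modulo 2.\<close>

section \<open>Cup products on cubical grids modulo 2\<close>

text \<open>No class is ever formed on a quotient of \<open>SU(3)\<close>. A class is represented by
  a boolean function of pairs \<open>(u, v)\<close>, possibly discontinuous, that changes by the
  right character under the two sign changes. On a grid its coboundary is supported where the
  function jumps, and a nonzero top product says that ten such functions jump at a common point. The
  signs of the real and imaginary part of the Hermitian product jump only at zeros, which forces
  this point to be an orthogonal pair. The function of a section is locally constant over the open
  set of the section and is extended outside by any function of the same character, so a cover
  leaves no room for a common jump. Each section yields either character at will: it selects a flex,
  all three coordinates of a flex are nonzero, and the product of any two of them carries a sign.
  Hence eight sections may be split into five and three; eight is the dimension of
  \<open>SU(3)\<close>.\<close>

lemma bit_add_self [simp]: "a + a = (0 :: bit)"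
  by (cases a) simp_all

lemma bit_add_self_left [simp]: "a + (a + b) = (b :: bit)"
  by (cases a; cases b) simp_all

declare add_bit_eq_xor [simp del] mult_bit_eq_and [simp del]
  bit_not_zero_iff [simp del] bit_not_one_iff [simp del]

text \<open>A cell of the integral cubical grid is the list of its doubled barycentre coordinates: an
  even entry is a grid point, an odd entry an open unit interval.  \<open>cob\<close> is the cellular
  coboundary modulo 2, its value at a cell being the sum over the facets.\<close>

fun cob :: "(int list \<Rightarrow> bit) \<Rightarrow> int list \<Rightarrow> bit" where
  "cob \<phi> [] = 0"
| "cob \<phi> (x # w) =
     (if odd x then \<phi> ((x - 1) # w) + \<phi> ((x + 1) # w) else 0) + cob (\<lambda>v. \<phi> (x # v)) w"

inductive facet :: "int list \<Rightarrow> int list \<Rightarrow> bool" where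
  lower: "odd x \<Longrightarrow> facet ((x - 1) # w) (x # w)"
| upper: "odd x \<Longrightarrow> facet ((x + 1) # w) (x # w)"
| Cons: "facet v w \<Longrightarrow> facet (x # v) (x # w)"

lemma cob_cong: "(\<And>v. facet v w \<Longrightarrow> \<phi> v = \<psi> v) \<Longrightarrow> cob \<phi> w = cob \<psi> w"
proof (induction w arbitrary: \<phi> \<psi>)
  case (Cons x w)
  have "cob (\<lambda>v. \<phi> (x # v)) w = cob (\<lambda>v. \<psi> (x # v)) w"
    by (intro Cons.IH Cons.prems facet.Cons)
  then show ?case
    using Cons.prems[of "(x - 1) # w"] Cons.prems[of "(x + 1) # w"]
    by (simp add: facet.lower facet.upper)
qed simp

lemma cob_zero [simp]: "cob (\<lambda>_. 0) w = 0"
  by (induction w) simp_all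

lemma cob_one [simp]: "cob (\<lambda>_. 1) w = 0"
  by (induction w) simp_all

lemma cob_add: "cob (\<lambda>v. \<phi> v + \<psi> v) w = cob \<phi> w + cob \<psi> w"
  by (induction w arbitrary: \<phi> \<psi>) (simp_all add: ac_simps)

lemma cob_cob [simp]: "cob (cob \<phi>) w = 0"
proof (induction w arbitrary: \<phi>)
  case (Cons x w)
  have "cob (\<lambda>v. cob \<phi> (x # v)) w =
      (if odd x then cob (\<lambda>v. \<phi> ((x - 1) # v)) w + cob (\<lambda>v. \<phi> ((x + 1) # v)) w else 0)"
    using Cons.IH[of "\<lambda>v. \<phi> (x # v)"] by (auto simp: cob_add)
  then show ?case
    by auto
qed simp

lemma cob_swap: "cob (\<lambda>v. cob (\<lambda>t. \<phi> v t) u) w = cob (\<lambda>t. cob (\<lambda>v. \<phi> v t) w) u"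
  by (induction w arbitrary: \<phi>) (simp_all add: cob_add)

lemma cob_uminus: "cob (\<lambda>v. \<phi> (map uminus v)) w = cob \<phi> (map uminus w)"
proof (induction w arbitrary: \<phi>)
  case (Cons x w)
  have "cob (\<lambda>v. \<phi> (- x # map uminus v)) w = cob (\<lambda>v. \<phi> (- x # v)) (map uminus w)"
    by (rule Cons.IH)
  moreover have "- (x - 1) = - x + 1" "- (x + 1) = - x - 1"
    by simp_all
  ultimately show ?case
    by (simp only: cob.simps list.map even_minus add.commute)
qed simp

text \<open>Sums over the top-dimensional cells of the cube \<open>[-2K, 2K]\<^sup>n\<close>, of its boundary, and of the
  closed half of the boundary of \<open>[-2K, 2K]\<^sup>n\<^sup>+\<^sup>1\<close> on which the first coordinate is nonnegative.\<close>

fun cube_sum :: "nat \<Rightarrow> nat \<Rightarrow> (int list \<Rightarrow> bit) \<Rightarrow> bit" where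
  "cube_sum K 0 \<phi> = \<phi> []"
| "cube_sum K (Suc n) \<phi> =
     (\<Sum>k<2 * K. cube_sum K n (\<lambda>w. \<phi> ((2 * int k + 1 - 2 * int K) # w)))"

fun sphere_sum :: "nat \<Rightarrow> nat \<Rightarrow> (int list \<Rightarrow> bit) \<Rightarrow> bit" where
  "sphere_sum K 0 \<phi> = 0"
| "sphere_sum K (Suc n) \<phi> =
     cube_sum K n (\<lambda>w. \<phi> (2 * int K # w)) + cube_sum K n (\<lambda>w. \<phi> (- 2 * int K # w)) +
     (\<Sum>k<2 * K. sphere_sum K n (\<lambda>w. \<phi> ((2 * int k + 1 - 2 * int K) # w)))"

definition hemi_sum :: "nat \<Rightarrow> nat \<Rightarrow> (int list \<Rightarrow> bit) \<Rightarrow> bit" where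
  "hemi_sum K n \<phi> = cube_sum K n (\<lambda>w. \<phi> (2 * int K # w)) +
     (\<Sum>k<K. sphere_sum K n (\<lambda>w. \<phi> ((2 * int k + 1) # w)))"

lemma cube_sum_zero [simp]: "cube_sum K n (\<lambda>_. 0) = 0"
  by (induction n) simp_all

lemma cube_sum_add: "cube_sum K n (\<lambda>w. \<phi> w + \<psi> w) = cube_sum K n \<phi> + cube_sum K n \<psi>"
  by (induction n arbitrary: \<phi> \<psi>) (simp_all add: sum.distrib)

lemma sphere_sum_zero [simp]: "sphere_sum K n (\<lambda>_. 0) = 0"
  by (induction n) simp_all

lemma sphere_sum_add: "sphere_sum K n (\<lambda>w. \<phi> w + \<psi> w) = sphere_sum K n \<phi> + sphere_sum K n \<psi>"
  by (induction n arbitrary: \<phi> \<psi>) (simp_all add: sum.distrib cube_sum_add ac_simps)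

lemma hemi_sum_zero [simp]: "hemi_sum K n (\<lambda>_. 0) = 0"
  by (simp add: hemi_sum_def)

lemma hemi_sum_add: "hemi_sum K n (\<lambda>w. \<phi> w + \<psi> w) = hemi_sum K n \<phi> + hemi_sum K n \<psi>"
  by (simp add: hemi_sum_def sum.distrib cube_sum_add sphere_sum_add ac_simps)

lemma hemi_sum_cob:
  "hemi_sum K n (\<lambda>w. cob (\<lambda>v. \<phi> v w) u) = cob (\<lambda>v. hemi_sum K n (\<lambda>w. \<phi> v w)) u"
  by (induction u arbitrary: \<phi>) (simp_all add: hemi_sum_add)

section \<open>Stokes' theorem for the cube, the sphere and the hemisphere\<close>

lemma telescope_bit:
  "(\<Sum>k<n. f (2 * int k + c) + f (2 * int k + 2 + c)) = f c + (f (2 * int n + c) :: bit)"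
  by (induction n) (simp_all add: algebra_simps)

text \<open>A facet between two neighbouring cells occurs twice and cancels modulo 2; telescoping in
  the first coordinate leaves the two outer faces.\<close>

lemma cube_sum_cob: "cube_sum K n (cob \<phi>) = sphere_sum K n \<phi>"
proof (induction n arbitrary: \<phi>)
  case (Suc n)
  define f where "f x = cube_sum K n (\<lambda>w. \<phi> (x # w))" for x
  have "cube_sum K (Suc n) (cob \<phi>) =
      (\<Sum>k<2 * K. f (2 * int k + (- 2 * int K)) + f (2 * int k + 2 + (- 2 * int K))) +
      (\<Sum>k<2 * K. sphere_sum K n (\<lambda>w. \<phi> ((2 * int k + 1 - 2 * int K) # w)))"
    by (simp add: cube_sum_add Suc.IH sum.distrib f_def algebra_simps)
  also have "(\<Sum>k<2 * K. f (2 * int k + (- 2 * int K)) + f (2 * int k + 2 + (- 2 * int K))) =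
      f (- 2 * int K) + f (2 * int K)"
    by (subst telescope_bit) simp
  finally show ?case
    by (simp add: f_def add.commute)
qed simp

lemma sphere_sum_cob: "sphere_sum K n (cob \<phi>) = 0"
proof (induction n arbitrary: \<phi>)
  case (Suc n)
  define f where "f x = sphere_sum K n (\<lambda>w. \<phi> (x # w))" for x
  have "(\<Sum>k<2 * K. sphere_sum K n (\<lambda>w. cob \<phi> ((2 * int k + 1 - 2 * int K) # w))) =
      (\<Sum>k<2 * K. f (2 * int k + (- 2 * int K)) + f (2 * int k + 2 + (- 2 * int K)))"
    by (simp add: sphere_sum_add Suc.IH f_def algebra_simps)
  also have "\<dots> = f (- 2 * int K) + f (2 * int K)"
    by (subst telescope_bit) simp
  finally show ?case
    by (simp add: cube_sum_cob f_def)
qed simp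

text \<open>The top face contributes its rim, the slabs telescope to the equator and the same rim,
  and the two copies of the rim cancel.\<close>

lemma hemi_sum_cob_eq: "hemi_sum K n (cob \<phi>) = sphere_sum K n (\<lambda>w. \<phi> (0 # w))"
proof -
  define f where "f x = sphere_sum K n (\<lambda>w. \<phi> (x # w))" for x
  have "(\<Sum>k<K. sphere_sum K n (\<lambda>w. cob \<phi> ((2 * int k + 1) # w))) =
      (\<Sum>k<K. f (2 * int k + 0) + f (2 * int k + 2 + 0))"
    by (simp add: sphere_sum_add sphere_sum_cob f_def algebra_simps)
  also have "\<dots> = f 0 + f (2 * int K)"
    by (subst telescope_bit) simp
  finally show ?thesis
    by (simp add: hemi_sum_def cube_sum_cob f_def)
qed

lemma cube_sum_uminus: "cube_sum K n (\<lambda>w. \<phi> (map uminus w)) = cube_sum K n \<phi>"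
proof (induction n arbitrary: \<phi>)
  case (Suc n)
  define f where "f x = cube_sum K n (\<lambda>w. \<phi> (x # w))" for x
  have "cube_sum K n (\<lambda>w. \<phi> (map uminus ((2 * int k + 1 - 2 * int K) # w))) =
      f (2 * int (2 * K - Suc k) + 1 - 2 * int K)" if "k < 2 * K" for k
  proof -
    have "- (2 * int k + 1 - 2 * int K) = 2 * int (2 * K - Suc k) + 1 - 2 * int K"
      using that by (simp add: of_nat_diff)
    moreover have "cube_sum K n (\<lambda>w. \<phi> (map uminus (x # w))) = f (- x)" for x
      using Suc.IH[of "\<lambda>w. \<phi> (- x # w)"] by (simp add: f_def)
    ultimately show ?thesis
      by metis
  qed
  then have "cube_sum K (Suc n) (\<lambda>w. \<phi> (map uminus w)) =
      (\<Sum>k<2 * K. f (2 * int (2 * K - Suc k) + 1 - 2 * int K))"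
    unfolding cube_sum.simps by (intro sum.cong) auto
  also have "\<dots> = (\<Sum>k<2 * K. f (2 * int k + 1 - 2 * int K))"
    by (rule sum.nat_diff_reindex[where g = "\<lambda>k. f (2 * int k + 1 - 2 * int K)"])
  also have "\<dots> = cube_sum K (Suc n) \<phi>"
    unfolding f_def by simp
  finally show ?case .
qed simp

lemma sphere_sum_uminus: "sphere_sum K n (\<lambda>w. \<phi> (map uminus w)) = sphere_sum K n \<phi>"
proof (induction n arbitrary: \<phi>)
  case (Suc n)
  define f where "f x = sphere_sum K n (\<lambda>w. \<phi> (x # w))" for x
  have "sphere_sum K n (\<lambda>w. \<phi> (map uminus ((2 * int k + 1 - 2 * int K) # w))) =
      f (2 * int (2 * K - Suc k) + 1 - 2 * int K)" if "k < 2 * K" for k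
  proof -
    have "- (2 * int k + 1 - 2 * int K) = 2 * int (2 * K - Suc k) + 1 - 2 * int K"
      using that by (simp add: of_nat_diff)
    moreover have "sphere_sum K n (\<lambda>w. \<phi> (map uminus (x # w))) = f (- x)" for x
      using Suc.IH[of "\<lambda>w. \<phi> (- x # w)"] by (simp add: f_def)
    ultimately show ?thesis
      by metis
  qed
  then have "(\<Sum>k<2 * K. sphere_sum K n (\<lambda>w. \<phi> (map uminus ((2 * int k + 1 - 2 * int K) # w)))) =
      (\<Sum>k<2 * K. f (2 * int (2 * K - Suc k) + 1 - 2 * int K))"
    by (intro sum.cong) auto
  also have "\<dots> = (\<Sum>k<2 * K. f (2 * int k + 1 - 2 * int K))"
    by (rule sum.nat_diff_reindex[where g = "\<lambda>k. f (2 * int k + 1 - 2 * int K)"])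
  finally show ?case
    using cube_sum_uminus[of K n "\<lambda>w. \<phi> (2 * int K # w)"]
      cube_sum_uminus[of K n "\<lambda>w. \<phi> (- 2 * int K # w)"]
    by (simp add: f_def add.commute)
qed simp

text \<open>The antipode exchanges the faces \<open>2 K\<close> and \<open>- 2 K\<close> and the
  slabs \<open>2 k + 1\<close> and \<open>- (2 k + 1)\<close>; on the remaining entries it is a
  negation, which \<open>cube_sum\<close> and \<open>sphere_sum\<close> do not see.\<close>

lemma sphere_sum_hemi_sum:
  "sphere_sum K (Suc n) \<phi> = hemi_sum K n (\<lambda>w. \<phi> w + \<phi> (map uminus w))"
proof -
  define f where "f x = sphere_sum K n (\<lambda>w. \<phi> (x # w))" for x
  have split: "(\<Sum>k<2 * K. f (2 * int k + 1 - 2 * int K)) =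
      (\<Sum>k<K. f (- (2 * int k + 1))) + (\<Sum>k<K. f (2 * int k + 1))"
  proof -
    have "(\<Sum>k<2 * K. f (2 * int k + 1 - 2 * int K)) =
        (\<Sum>k<K. f (2 * int k + 1 - 2 * int K)) + (\<Sum>k\<in>{K..<2 * K}. f (2 * int k + 1 - 2 * int K))"
      unfolding lessThan_atLeast0 by (rule sum.atLeastLessThan_concat[symmetric]) simp_all
    also have "(\<Sum>k<K. f (2 * int k + 1 - 2 * int K)) =
        (\<Sum>k<K. f (- (2 * int (K - Suc k) + 1)))"
      by (intro sum.cong refl arg_cong[of _ _ f]) (simp add: of_nat_diff)
    also have "\<dots> = (\<Sum>k<K. f (- (2 * int k + 1)))"
      by (rule sum.nat_diff_reindex[where g = "\<lambda>k. f (- (2 * int k + 1))"])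
    also have "(\<Sum>k\<in>{K..<2 * K}. f (2 * int k + 1 - 2 * int K)) = (\<Sum>k<K. f (2 * int k + 1))"
      by (rule sum.reindex_bij_witness[of _ "\<lambda>k. k + K" "\<lambda>k. k - K"])
        (auto simp: of_nat_diff algebra_simps)
    finally show ?thesis .
  qed
  define g where "g x = cube_sum K n (\<lambda>w. \<phi> (x # w))" for x
  have f: "sphere_sum K n (\<lambda>w. \<phi> (x # map uminus w)) = f x" for x
    using sphere_sum_uminus[of K n "\<lambda>w. \<phi> (x # w)"] by (simp add: f_def)
  have g: "cube_sum K n (\<lambda>w. \<phi> (x # map uminus w)) = g x" for x
    using cube_sum_uminus[of K n "\<lambda>w. \<phi> (x # w)"] by (simp add: g_def)
  have "sphere_sum K (Suc n) \<phi> =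
      g (2 * int K) + g (- 2 * int K) + (\<Sum>k<2 * K. f (2 * int k + 1 - 2 * int K))"
    unfolding f_def g_def by simp
  also have "\<dots> = (g (2 * int K) + (\<Sum>k<K. f (2 * int k + 1))) +
      (g (- 2 * int K) + (\<Sum>k<K. f (- (2 * int k + 1))))"
    unfolding split by (simp only: ac_simps)
  also have "g (2 * int K) + (\<Sum>k<K. f (2 * int k + 1)) = hemi_sum K n \<phi>"
    unfolding hemi_sum_def f_def g_def ..
  also have "g (- 2 * int K) + (\<Sum>k<K. f (- (2 * int k + 1))) =
      hemi_sum K n (\<lambda>w. \<phi> (map uminus w))"
    unfolding hemi_sum_def list.map f g by simp
  finally show ?thesis
    by (simp only: hemi_sum_add)
qed

section \<open>Faces of the boundary of the cube\<close>

definition cell :: "nat \<Rightarrow> nat \<Rightarrow> int list \<Rightarrow> bool" where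
  "cell K n w \<longleftrightarrow> length w = n \<and> (\<forall>x\<in>set w. \<bar>x\<bar> \<le> 2 * int K) \<and> (\<exists>x\<in>set w. \<bar>x\<bar> = 2 * int K)"

lemma facet_length: "facet v w \<Longrightarrow> length v = length w"
  by (induction rule: facet.induct) simp_all

lemma facet_bounded:
  assumes "facet v w" "\<forall>x\<in>set w. \<bar>x\<bar> \<le> 2 * int K"
  shows "\<forall>x\<in>set v. \<bar>x\<bar> \<le> 2 * int K"
  using assms
proof induction
  case (lower x w)
  then have "x \<noteq> - (2 * int K)" "\<bar>x\<bar> \<le> 2 * int K"
    by auto
  then have "\<bar>x - 1\<bar> \<le> 2 * int K"
    by linarith
  then show ?case
    using lower by simp
next
  case (upper x w)
  then have "x \<noteq> 2 * int K" "\<bar>x\<bar> \<le> 2 * int K"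
    by auto
  then have "\<bar>x + 1\<bar> \<le> 2 * int K"
    by linarith
  then show ?case
    using upper by simp
qed simp

text \<open>An extreme entry is even, and passing to a facet changes an odd entry only; so faces of
  boundary cells stay in the boundary.\<close>

lemma facet_extreme:
  assumes "facet v w" "\<bar>y\<bar> = 2 * int K" "y \<in> set w"
  shows "y \<in> set v"
  using assms
proof induction
  case (lower x w)
  have "even y"
    using lower(2) by (metis dvd_abs_iff dvd_triv_left)
  then show ?case
    using lower by auto
next
  case (upper x w)
  have "even y"
    using upper(2) by (metis dvd_abs_iff dvd_triv_left)
  then show ?case
    using upper by auto
qed auto

lemma facet_cell:
  assumes "facet v w" "cell K n w"
  shows "cell K n v"
proof -
  obtain y where "y \<in> set w" "\<bar>y\<bar> = 2 * int K"
    using assms(2) by (auto simp: cell_def)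
  then have "y \<in> set v" "\<bar>y\<bar> = 2 * int K"
    using facet_extreme[OF assms(1)] by auto
  moreover have "\<forall>x\<in>set v. \<bar>x\<bar> \<le> 2 * int K"
    using facet_bounded[OF assms(1)] assms(2) by (simp add: cell_def)
  ultimately show ?thesis
    using facet_length[OF assms(1)] assms(2) by (auto simp: cell_def)
qed

lemma cube_sum_cong:
  assumes "\<And>w. length w = n \<Longrightarrow> \<forall>x\<in>set w. \<bar>x\<bar> \<le> 2 * int K \<Longrightarrow> \<phi> w = \<psi> w"
  shows "cube_sum K n \<phi> = cube_sum K n \<psi>"
  using assms
proof (induction n arbitrary: \<phi> \<psi>)
  case (Suc n)
  show ?case
    unfolding cube_sum.simps by (intro sum.cong Suc.IH Suc.prems) auto
qed simp

lemma sphere_sum_cong: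
  assumes "\<And>w. cell K n w \<Longrightarrow> \<phi> w = \<psi> w"
  shows "sphere_sum K n \<phi> = sphere_sum K n \<psi>"
  using assms
proof (induction n arbitrary: \<phi> \<psi>)
  case (Suc n)
  show ?case
    unfolding sphere_sum.simps
    by (intro arg_cong2[of _ _ _ _ "(+)"] sum.cong Suc.IH cube_sum_cong Suc.prems)
      (auto simp: cell_def)
qed simp

lemma hemi_sum_cong:
  assumes "\<And>w. cell K (Suc n) w \<Longrightarrow> \<phi> w = \<psi> w"
  shows "hemi_sum K n \<phi> = hemi_sum K n \<psi>"
  unfolding hemi_sum_def
  by (intro arg_cong2[of _ _ _ _ "(+)"] sum.cong sphere_sum_cong cube_sum_cong assms)
    (auto simp: cell_def)

text \<open>The \<open>i\<close>-dimensional hemispheres are nested in the last coordinates.\<close>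

definition hemi :: "nat \<Rightarrow> nat \<Rightarrow> nat \<Rightarrow> (int list \<Rightarrow> bit) \<Rightarrow> bit" where
  "hemi K m i \<phi> = hemi_sum K i (\<lambda>w. \<phi> (replicate (m - i) 0 @ w))"

lemma cob_replicate: "cob \<phi> (replicate r 0 @ w) = cob (\<lambda>v. \<phi> (replicate r 0 @ v)) w"
  by (induction r arbitrary: \<phi>) simp_all

lemma hemi_zero [simp]: "hemi K m i (\<lambda>_. 0) = 0"
  by (simp add: hemi_def)

lemma hemi_add: "hemi K m i (\<lambda>w. \<phi> w + \<psi> w) = hemi K m i \<phi> + hemi K m i \<psi>"
  by (simp add: hemi_def hemi_sum_add)

lemma hemi_mult_left: "hemi K m i (\<lambda>w. c * \<phi> w) = c * hemi K m i \<phi>"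
  by (cases c) simp_all

lemma hemi_cob: "hemi K m i (\<lambda>w. cob (\<lambda>v. \<phi> v w) u) = cob (\<lambda>v. hemi K m i (\<lambda>w. \<phi> v w)) u"
  by (simp add: hemi_def hemi_sum_cob)

lemma hemi_cong:
  assumes "i \<le> m" "\<And>w. cell K (Suc m) w \<Longrightarrow> \<phi> w = \<psi> w"
  shows "hemi K m i \<phi> = hemi K m i \<psi>"
  unfolding hemi_def
proof (intro hemi_sum_cong assms(2))
  fix w assume "cell K (Suc i) w"
  then show "cell K (Suc m) (replicate (m - i) 0 @ w)"
    using assms(1) by (auto simp: cell_def)
qed

lemma hemi_cob_0: "hemi K m 0 (cob \<phi>) = 0"
  by (simp add: hemi_def cob_replicate hemi_sum_cob_eq)

text \<open>The cell structure behind the cohomology of real projective space: the boundary of a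
  hemisphere is the next lower hemisphere together with its antipode.\<close>

lemma hemi_cob_Suc:
  assumes "i < m"
  shows "hemi K m (Suc i) (cob \<phi>) = hemi K m i (\<lambda>w. \<phi> w + \<phi> (map uminus w))"
proof -
  have *: "replicate (m - i) (0::int) = replicate (m - Suc i) 0 @ [0]"
    using assms by (metis Suc_diff_Suc replicate_Suc replicate_append_same)
  show ?thesis
    unfolding hemi_def cob_replicate hemi_sum_cob_eq sphere_sum_hemi_sum * by simp
qed

lemma hemi_0_one: "hemi K m 0 (\<lambda>_. 1) = 1"
  by (simp add: hemi_def hemi_sum_def)


section \<open>Cochains and cup products on the product of two grids\<close>

definition cob2 :: "(int list \<times> int list \<Rightarrow> bit) \<Rightarrow> int list \<times> int list \<Rightarrow> bit" where
  "cob2 \<phi> = (\<lambda>(s, t). cob (\<lambda>v. \<phi> (v, t)) s + cob (\<lambda>v. \<phi> (s, v)) t)"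

definition facet2 :: "int list \<times> int list \<Rightarrow> int list \<times> int list \<Rightarrow> bool" where
  "facet2 d c \<longleftrightarrow> facet (fst d) (fst c) \<and> snd d = snd c \<or> fst d = fst c \<and> facet (snd d) (snd c)"

definition cell2 :: "nat \<Rightarrow> nat \<Rightarrow> nat \<Rightarrow> int list \<times> int list \<Rightarrow> bool" where
  "cell2 K m n c \<longleftrightarrow> cell K (Suc m) (fst c) \<and> cell K (Suc n) (snd c)"

lemma facet2_cell2: "facet2 d c \<Longrightarrow> cell2 K m n c \<Longrightarrow> cell2 K m n d"
  by (auto simp: facet2_def cell2_def intro: facet_cell)

lemma cob2_cong: "(\<And>d. facet2 d c \<Longrightarrow> \<phi> d = \<psi> d) \<Longrightarrow> cob2 \<phi> c = cob2 \<psi> c"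
  unfolding cob2_def split_beta facet2_def
  by (intro arg_cong2[of _ _ _ _ "(+)"] cob_cong) auto

lemma cob2_zero [simp]: "cob2 (\<lambda>_. 0) c = 0"
  by (cases c) (simp add: cob2_def)

lemma cob2_one [simp]: "cob2 (\<lambda>_. 1) c = 0"
  by (cases c) (simp add: cob2_def)

lemma cob2_add: "cob2 (\<lambda>v. \<phi> v + \<psi> v) c = cob2 \<phi> c + cob2 \<psi> c"
  by (cases c) (simp add: cob2_def cob_add ac_simps)

lemma cob2_mult_right: "cob2 (\<lambda>v. \<phi> v * a) c = cob2 \<phi> c * a"
  by (cases a) simp_all

lemma cob2_cob2 [simp]: "cob2 (cob2 \<phi>) c = 0"
proof (cases c)
  case (Pair s t)
  then show ?thesis
    using cob_cob[of "\<lambda>v. \<phi> (v, t)" s] cob_cob[of "\<lambda>v. \<phi> (s, v)" t]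
      cob_swap[of "\<lambda>v u. \<phi> (v, u)" t s]
    by (simp add: cob2_def cob_add)
qed

lemma cob2_nonzero_facet: "cob2 \<phi> c \<noteq> 0 \<Longrightarrow> \<exists>d. facet2 d c \<and> \<phi> d \<noteq> 0"
  using cob2_cong[of c \<phi> "\<lambda>_. 0"] cob2_zero[of c] by metis

text \<open>The cup product of the coboundaries of \<open>e 0, \<dots>, e (k - 1)\<close>, evaluated on the barycentric
  subdivision of a cell.\<close>

fun cup :: "(nat \<Rightarrow> int list \<times> int list \<Rightarrow> bit) \<Rightarrow> nat \<Rightarrow> int list \<times> int list \<Rightarrow> bit" where
  "cup e 0 = (\<lambda>_. 1)"
| "cup e (Suc k) = cob2 (\<lambda>d. cup e k d * e k d)"

lemma cob2_cup [simp]: "cob2 (cup e k) c = 0"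
  by (cases k) simp_all

lemma cup_nonzero_facet:
  assumes "cup e (Suc k) c \<noteq> 0"
  shows "\<exists>d. facet2 d c \<and> cup e k d \<noteq> 0 \<and> e k d \<noteq> e k c"
proof -
  \<comment> \<open>\<open>cup e k\<close> is a cocycle, so the constant \<open>e k c\<close> may be
    added to the second factor; each summand then contains the jump of \<open>e k\<close> from
    \<open>d\<close> to \<open>c\<close>.\<close>
  have "cob2 (\<lambda>d. cup e k d * (e k d + e k c)) c = cup e (Suc k) c"
    by (simp add: distrib_left cob2_add cob2_mult_right)
  then obtain d where "facet2 d c" "cup e k d * (e k d + e k c) \<noteq> 0"
    using assms cob2_nonzero_facet[of "\<lambda>d. cup e k d * (e k d + e k c)" c] by auto
  moreover from this have "e k d \<noteq> e k c"
    by auto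
  ultimately show ?thesis
    by (intro exI[of _ d]) auto
qed

abbreviation negA :: "int list \<times> int list \<Rightarrow> int list \<times> int list" where
  "negA \<equiv> map_prod (map uminus) id"

abbreviation negB :: "int list \<times> int list \<Rightarrow> int list \<times> int list" where
  "negB \<equiv> map_prod id (map uminus)"

lemma cob2_negA: "cob2 \<phi> (negA c) = cob2 (\<lambda>d. \<phi> (negA d)) c"
  by (cases c) (simp add: cob2_def cob_uminus[of "\<lambda>v. \<phi> (v, _)", symmetric])

lemma cob2_negB: "cob2 \<phi> (negB c) = cob2 (\<lambda>d. \<phi> (negB d)) c"
  by (cases c) (simp add: cob2_def cob_uminus[of "\<lambda>v. \<phi> (_, v)", symmetric])

text \<open>Under \<open>g\<close> each \<open>e k\<close> changes by a constant, which contributes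
  a multiple of the coboundary of the cocycle \<open>cup e k\<close>, that is, nothing.\<close>

lemma cup_invariant:
  assumes cob2_g: "\<And>\<phi> c. cob2 \<phi> (g c) = cob2 (\<lambda>d. \<phi> (g d)) c"
    and e: "\<And>k c. k < l \<Longrightarrow> cell2 K m n c \<Longrightarrow> e k (g c) = e k c + a k"
  shows "k \<le> l \<Longrightarrow> cell2 K m n c \<Longrightarrow> cup e k (g c) = cup e k c"
proof (induction k arbitrary: c)
  case (Suc k)
  have "cup e (Suc k) (g c) = cob2 (\<lambda>d. cup e k (g d) * e k (g d)) c"
    by (simp add: cob2_g)
  also have "\<dots> = cob2 (\<lambda>d. cup e k d * e k d + cup e k d * a k) c"
    using Suc.prems facet2_cell2[OF _ Suc.prems(2)]
    by (intro cob2_cong) (simp add: Suc.IH e distrib_left)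
  also have "\<dots> = cup e (Suc k) c"
    by (simp add: cob2_add cob2_mult_right)
  finally show ?case .
qed simp

definition hemi2 :: "nat \<Rightarrow> nat \<Rightarrow> nat \<Rightarrow> nat \<Rightarrow> nat \<Rightarrow> (int list \<times> int list \<Rightarrow> bit) \<Rightarrow> bit" where
  "hemi2 K m n i j \<phi> = hemi K m i (\<lambda>s. hemi K n j (\<lambda>t. \<phi> (s, t)))"

lemma hemi2_cob2:
  "hemi2 K m n i j (cob2 \<phi>) =
     hemi K m i (cob (\<lambda>s. hemi K n j (\<lambda>t. \<phi> (s, t)))) +
     hemi K m i (\<lambda>s. hemi K n j (cob (\<lambda>t. \<phi> (s, t))))"
  by (simp add: hemi2_def cob2_def hemi_add hemi_cob)

lemma hemi2_cong:
  assumes "i \<le> m" "j \<le> n" "\<And>c. cell2 K m n c \<Longrightarrow> \<phi> c = \<psi> c"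
  shows "hemi2 K m n i j \<phi> = hemi2 K m n i j \<psi>"
  unfolding hemi2_def by (intro hemi_cong assms) (auto simp: cell2_def)

lemma hemi2_nonzero:
  assumes "i \<le> m" "j \<le> n" "hemi2 K m n i j \<phi> \<noteq> 0"
  shows "\<exists>c. cell2 K m n c \<and> \<phi> c \<noteq> 0"
  using hemi2_cong[OF assms(1,2), of K \<phi> "\<lambda>_. 0"] assms(3) by (auto simp: hemi2_def)

text \<open>Stokes' theorem on a product of hemispheres: the boundary pairs each cell with its image
  under \<open>negA\<close> or \<open>negB\<close>, where \<open>cup e k * e k\<close> changes by
  \<open>a k\<close> or \<open>b k\<close> times \<open>cup e k\<close>. This is the recursion for
  the coefficient of \<open>\<alpha>^i \<beta>^j\<close> in the product of the linear forms
  \<open>a l \<alpha> + b l \<beta>\<close>.\<close>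

lemma hemi2_cup_Suc:
  assumes ij: "i \<le> m" "j \<le> n"
    and A: "\<And>l c. l \<le> k \<Longrightarrow> cell2 K m n c \<Longrightarrow> e l (negA c) = e l c + a l"
    and B: "\<And>l c. l \<le> k \<Longrightarrow> cell2 K m n c \<Longrightarrow> e l (negB c) = e l c + b l"
  shows "hemi2 K m n i j (cup e (Suc k)) =
    (if i = 0 then 0 else a k * hemi2 K m n (i - 1) j (cup e k)) +
    (if j = 0 then 0 else b k * hemi2 K m n i (j - 1) (cup e k))"
proof -
  define \<phi> where "\<phi> = (\<lambda>d. cup e k d * e k d)"
  have \<phi>A: "\<phi> c + \<phi> (negA c) = a k * cup e k c" if "cell2 K m n c" for c
    using cup_invariant[of negA "Suc k" K m n e a k c] cob2_negA A that
    by (simp add: \<phi>_def distrib_left mult.commute)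
  have \<phi>B: "\<phi> c + \<phi> (negB c) = b k * cup e k c" if "cell2 K m n c" for c
    using cup_invariant[of negB "Suc k" K m n e b k c] cob2_negB B that
    by (simp add: \<phi>_def distrib_left mult.commute)
  have "hemi K m i (cob (\<lambda>s. hemi K n j (\<lambda>t. \<phi> (s, t)))) =
      (if i = 0 then 0 else a k * hemi2 K m n (i - 1) j (cup e k))"
  proof (cases i)
    case (Suc i')
    have "hemi K m i (cob (\<lambda>s. hemi K n j (\<lambda>t. \<phi> (s, t)))) =
        hemi2 K m n i' j (\<lambda>c. \<phi> c + \<phi> (negA c))"
      using ij by (simp add: Suc hemi_cob_Suc hemi2_def hemi_add)
    also have "\<dots> = hemi2 K m n i' j (\<lambda>c. a k * cup e k c)"
      using ij Suc by (intro hemi2_cong \<phi>A) auto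
    finally show ?thesis
      by (simp add: hemi2_def hemi_mult_left Suc)
  qed (simp add: hemi_cob_0)
  moreover have "hemi K m i (\<lambda>s. hemi K n j (cob (\<lambda>t. \<phi> (s, t)))) =
      (if j = 0 then 0 else b k * hemi2 K m n i (j - 1) (cup e k))"
  proof (cases j)
    case (Suc j')
    have "hemi K m i (\<lambda>s. hemi K n j (cob (\<lambda>t. \<phi> (s, t)))) =
        hemi2 K m n i j' (\<lambda>c. \<phi> c + \<phi> (negB c))"
      using ij by (simp add: Suc hemi_cob_Suc hemi2_def)
    also have "\<dots> = hemi2 K m n i j' (\<lambda>c. b k * cup e k c)"
      using ij Suc by (intro hemi2_cong \<phi>B) auto
    finally show ?thesis
      by (simp add: hemi2_def hemi_mult_left Suc)
  qed (simp add: hemi_cob_0)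
  ultimately show ?thesis
    by (simp add: hemi2_cob2 flip: \<phi>_def)
qed

text \<open>In cohomological terms: \<open>\<alpha>\<^sup>m \<beta>\<^sup>n \<noteq> 0\<close> in the cohomology of \<open>\<real>P\<^sup>m \<times> \<real>P\<^sup>n\<close>, and since
  \<open>\<alpha>\<^sup>m\<^sup>+\<^sup>1 = 0\<close> any number of the factors \<open>\<beta>\<close> may be replaced by \<open>\<alpha> + \<beta>\<close>.\<close>

lemma hemi2_cup_top:
  assumes A: "\<And>l c. l < n + m \<Longrightarrow> cell2 K m n c \<Longrightarrow> e l (negA c) = e l c + a l"
    and B: "\<And>l c. l < n + m \<Longrightarrow> cell2 K m n c \<Longrightarrow> e l (negB c) = e l c + b l"
    and low: "\<And>l. l < n \<Longrightarrow> b l = 1"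
    and high: "\<And>l. n \<le> l \<Longrightarrow> l < n + m \<Longrightarrow> a l = 1 \<and> b l = 0"
  shows "hemi2 K m n m n (cup e (n + m)) = 1"
proof -
  \<comment> \<open>Over a point of the first sphere \<open>\<alpha>\<close> vanishes, so each of
    the first \<open>n\<close> factors acts as \<open>\<beta>\<close>.\<close>
  have "j \<le> n \<Longrightarrow> hemi2 K m n 0 j (cup e j) = 1" for j
  proof (induction j)
    case 0
    then show ?case
      by (simp add: hemi2_def hemi_0_one)
  next
    case (Suc j)
    then show ?case
      by (subst hemi2_cup_Suc[where a = a and b = b]) (auto simp: A B low)
  qed
  then have *: "hemi2 K m n 0 n (cup e n) = 1"
    by simp
  \<comment> \<open>The last \<open>m\<close> factors are \<open>\<alpha>\<close> alone and raise
    only the dimension in the first sphere.\<close>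
  have "i \<le> m \<Longrightarrow> hemi2 K m n i n (cup e (n + i)) = 1" for i
  proof (induction i)
    case (Suc i)
    then show ?case
      using high[of "n + i"] by (subst add_Suc_right, subst hemi2_cup_Suc[where a = a and b = b]) (auto simp: A B)
  qed (simp add: *)
  then show ?thesis
    by simp
qed

section \<open>A Borsuk-Ulam theorem for products of spheres\<close>

lemma facet_update:
  "facet v w \<Longrightarrow> \<exists>i c. i < length w \<and> \<bar>c\<bar> = 1 \<and> v = w[i := w ! i + c]"
proof (induction rule: facet.induct)
  case (lower x w)
  show ?case
    by (intro exI[of _ 0] exI[of _ "- 1"]) simp
next
  case (upper x w)
  show ?case
    by (intro exI[of _ 0] exI[of _ 1]) simp
next
  case (Cons v w x)
  then obtain i c where "i < length w" "\<bar>c\<bar> = 1" "v = w[i := w ! i + c]"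
    by blast
  then show ?case
    by (intro exI[of _ "Suc i"] exI[of _ c]) simp
qed

text \<open>The barycentre of the cell, scaled so that boundary cells land on the unit sphere of the
  maximum norm.\<close>

definition grid_point :: "nat \<Rightarrow> (nat \<Rightarrow> 'a) \<Rightarrow> int list \<Rightarrow> 'a::euclidean_space" where
  "grid_point K f w = (\<Sum>i<DIM('a). (of_int (w ! i) / (2 * real K)) *\<^sub>R f i)"

lemma grid_point_inner:
  fixes f :: "nat \<Rightarrow> 'a::euclidean_space"
  assumes f: "bij_betw f {..<DIM('a)} Basis" and i: "i < DIM('a)"
  shows "grid_point K f w \<bullet> f i = of_int (w ! i) / (2 * real K)"
proof -
  have "f j \<bullet> f i = (if j = i then 1 else 0)" if j: "j < DIM('a)" for j
  proof -
    have "f j \<in> Basis" "f i \<in> Basis" "f j = f i \<longleftrightarrow> j = i"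
      using bij_betwE[OF f] bij_betw_imp_inj_on[OF f] i j by (auto simp: inj_on_eq_iff)
    then show ?thesis
      by (simp add: inner_Basis)
  qed
  then have "grid_point K f w \<bullet> f i =
      (\<Sum>j<DIM('a). if j = i then of_int (w ! j) / (2 * real K) else 0)"
    unfolding grid_point_def inner_sum_left inner_scaleR_left by (intro sum.cong) auto
  then show ?thesis
    using i by simp
qed

lemma grid_point_uminus:
  fixes f :: "nat \<Rightarrow> 'a::euclidean_space"
  assumes "length w = DIM('a)"
  shows "grid_point K f (map uminus w) = - grid_point K f w"
  using assms by (simp add: grid_point_def sum_negf)

lemma norm_grid_point:
  fixes f :: "nat \<Rightarrow> 'a::euclidean_space"
  assumes f: "bij_betw f {..<DIM('a)} Basis" and "K > 0" and w: "cell K DIM('a) w"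
  shows "1 \<le> norm (grid_point K f w)" "norm (grid_point K f w) \<le> DIM('a)"
proof -
  obtain y where y: "y \<in> set w" "\<bar>y\<bar> = 2 * int K"
    using w by (auto simp: cell_def)
  then obtain i where i: "i < DIM('a)" "w ! i = y"
    using w by (auto simp: cell_def in_set_conv_nth)
  have "\<bar>real_of_int y\<bar> = 2 * real K"
    using y(2) by linarith
  then have "\<bar>grid_point K f w \<bullet> f i\<bar> = 1"
    using grid_point_inner[OF f i(1), of K w] i(2) \<open>K > 0\<close> by (simp add: abs_divide)
  moreover have "f i \<in> Basis"
    using f i(1) by (auto simp: bij_betw_def)
  ultimately show "1 \<le> norm (grid_point K f w)"
    using Basis_le_norm[of "f i" "grid_point K f w"] by simp
  have "\<bar>grid_point K f w \<bullet> b\<bar> \<le> 1" if b: "b \<in> Basis" for b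
  proof -
    obtain j where j: "j < DIM('a)" "b = f j"
      using f b by (auto simp: bij_betw_def)
    have "\<bar>w ! j\<bar> \<le> 2 * int K"
      using w j(1) by (simp add: cell_def)
    then have "\<bar>real_of_int (w ! j)\<bar> \<le> 2 * real K"
      by linarith
    then show ?thesis
      using \<open>K > 0\<close> by (simp add: j(2) grid_point_inner[OF f j(1)] abs_divide)
  qed
  then have "(\<Sum>b\<in>Basis. \<bar>grid_point K f w \<bullet> b\<bar>) \<le> DIM('a)"
    using sum_bounded_above[of Basis "\<lambda>b. \<bar>grid_point K f w \<bullet> b\<bar>" 1] by simp
  then show "norm (grid_point K f w) \<le> DIM('a)"
    using norm_le_l1[of "grid_point K f w"] by simp
qed

lemma dist_grid_point_facet:
  fixes f :: "nat \<Rightarrow> 'a::euclidean_space"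
  assumes f: "bij_betw f {..<DIM('a)} Basis" and "facet v w" "length w = DIM('a)"
  shows "dist (grid_point K f v) (grid_point K f w) \<le> 1 / (2 * real K)"
proof -
  obtain i c where ic: "i < length w" "\<bar>c\<bar> = 1" "v = w[i := w ! i + c]"
    using facet_update[OF assms(2)] by blast
  have "grid_point K f v - grid_point K f w =
      (\<Sum>j<DIM('a). if j = i then (of_int c / (2 * real K)) *\<^sub>R f j else 0)"
    unfolding grid_point_def sum_subtractf[symmetric]
    using ic assms(3)
    by (intro sum.cong) (auto simp: nth_list_update add_divide_distrib simp flip: scaleR_diff_left)
  also have "\<dots> = (of_int c / (2 * real K)) *\<^sub>R f i"
    using ic assms(3) by simp
  finally have "dist (grid_point K f v) (grid_point K f w) =
      norm ((of_int c / (2 * real K)) *\<^sub>R f i)"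
    by (simp add: dist_norm)
  moreover have "norm (f i) = 1"
    using f ic assms(3) by (intro norm_Basis) (auto simp: bij_betw_def)
  moreover have "\<bar>real_of_int c\<bar> = 1"
    using ic(2) by linarith
  ultimately show ?thesis
    by (simp add: abs_divide)
qed

text \<open>A nonzero cup product is witnessed by a chain of \<open>k\<close> successive facets in
  which each \<open>e j\<close> jumps at its own step; the whole chain stays within \<open>k\<close>
  steps of \<open>c\<close>.\<close>

lemma cup_nonzero_close:
  fixes P :: "int list \<times> int list \<Rightarrow> 'x::metric_space"
  assumes close: "\<And>d c. facet2 d c \<Longrightarrow> cell2 K m n c \<Longrightarrow> dist (P d) (P c) \<le> \<delta>" and "\<delta> \<ge> 0"
  shows "cell2 K m n c \<Longrightarrow> cup e k c \<noteq> 0 \<Longrightarrow> j < k \<Longrightarrow>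
    \<exists>d d'. dist (P d) (P c) \<le> real k * \<delta> \<and> dist (P d') (P c) \<le> real k * \<delta> \<and> e j d \<noteq> e j d'"
proof (induction k arbitrary: c)
  case (Suc k)
  obtain d where d: "facet2 d c" "cup e k d \<noteq> 0" "e k d \<noteq> e k c"
    using cup_nonzero_facet[OF Suc.prems(2)] by blast
  have dc: "dist (P d) (P c) \<le> \<delta>"
    using close d(1) Suc.prems(1) by blast
  show ?case
  proof (cases "j = k")
    case True
    have "0 \<le> real k * \<delta>"
      using \<open>\<delta> \<ge> 0\<close> by simp
    then have "dist (P d) (P c) \<le> real (Suc k) * \<delta>" "dist (P c) (P c) \<le> real (Suc k) * \<delta>"
      using dc \<open>\<delta> \<ge> 0\<close> by (simp_all add: distrib_right add_increasing2)
    then show ?thesis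
      using d(3) True by blast
  next
    case False
    then obtain a b where ab: "dist (P a) (P d) \<le> real k * \<delta>" "dist (P b) (P d) \<le> real k * \<delta>"
      "e j a \<noteq> e j b"
      using Suc.IH[OF facet2_cell2[OF d(1) Suc.prems(1)] d(2)] Suc.prems(3) by auto
    have "dist (P a) (P c) \<le> real (Suc k) * \<delta>" "dist (P b) (P c) \<le> real (Suc k) * \<delta>"
      using ab dc dist_triangle[of "P a" "P c" "P d"] dist_triangle[of "P b" "P c" "P d"]
      by (simp_all add: distrib_right)
    then show ?thesis
      using ab(3) by blast
  qed
qed simp

lemma borsuk_ulam_grid:
  fixes \<epsilon> :: "nat \<Rightarrow> 'a::euclidean_space \<times> 'b::euclidean_space \<Rightarrow> bool" and a b :: "nat \<Rightarrow> bool"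
    and K :: nat
  assumes dim: "DIM('a) = Suc m" "DIM('b) = Suc n" and "K > 0"
    and A: "\<And>j u v. j < n + m \<Longrightarrow> u \<noteq> 0 \<Longrightarrow> v \<noteq> 0 \<Longrightarrow> \<epsilon> j (- u, v) \<longleftrightarrow> \<epsilon> j (u, v) \<noteq> a j"
    and B: "\<And>j u v. j < n + m \<Longrightarrow> u \<noteq> 0 \<Longrightarrow> v \<noteq> 0 \<Longrightarrow> \<epsilon> j (u, - v) \<longleftrightarrow> \<epsilon> j (u, v) \<noteq> b j"
    and low: "\<And>j. j < n \<Longrightarrow> b j"
    and high: "\<And>j. n \<le> j \<Longrightarrow> j < n + m \<Longrightarrow> a j \<and> \<not> b j"
  shows "\<exists>u v. norm u \<in> {1..real DIM('a)} \<and> norm v \<in> {1..real DIM('b)} \<and>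
    (\<forall>j<n + m. \<exists>p q. dist p (u, v) \<le> real (n + m) / real K \<and> dist q (u, v) \<le> real (n + m) / real K \<and> \<epsilon> j p \<noteq> \<epsilon> j q)"
proof -
  obtain f :: "nat \<Rightarrow> 'a" where f: "bij_betw f {..<DIM('a)} Basis"
    using ex_bij_betw_nat_finite[of "Basis :: 'a set"] by (auto simp: atLeast0LessThan)
  obtain g :: "nat \<Rightarrow> 'b" where g: "bij_betw g {..<DIM('b)} Basis"
    using ex_bij_betw_nat_finite[of "Basis :: 'b set"] by (auto simp: atLeast0LessThan)
  define P where "P c = (grid_point K f (fst c), grid_point K g (snd c))" for c
  define e :: "nat \<Rightarrow> int list \<times> int list \<Rightarrow> bit" where "e j c = of_bool (\<epsilon> j (P c))" for j c
  have norms: "norm (fst (P c)) \<in> {1..real DIM('a)}" "norm (snd (P c)) \<in> {1..real DIM('b)}"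
    if "cell2 K m n c" for c
    using norm_grid_point[OF f \<open>K > 0\<close>, of "fst c"] norm_grid_point[OF g \<open>K > 0\<close>, of "snd c"] that
    by (auto simp: cell2_def P_def dim)
  then have nz: "fst (P c) \<noteq> 0" "snd (P c) \<noteq> 0" if "cell2 K m n c" for c
    using that by fastforce+
  have eA: "e j (negA c) = e j c + of_bool (a j)" if "j < n + m" "cell2 K m n c" for j c
  proof -
    have "P (negA c) = (- fst (P c), snd (P c))"
      using that(2) by (simp add: P_def grid_point_uminus cell2_def cell_def dim)
    then show ?thesis
      using A[OF that(1) nz[OF that(2)]] by (auto simp: e_def)
  qed
  have eB: "e j (negB c) = e j c + of_bool (b j)" if "j < n + m" "cell2 K m n c" for j c
  proof -
    have "P (negB c) = (fst (P c), - snd (P c))"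
      using that(2) by (simp add: P_def grid_point_uminus cell2_def cell_def dim)
    then show ?thesis
      using B[OF that(1) nz[OF that(2)]] by (auto simp: e_def)
  qed
  have "hemi2 K m n m n (cup e (n + m)) = 1"
    by (rule hemi2_cup_top[where a = "\<lambda>j. of_bool (a j)" and b = "\<lambda>j. of_bool (b j)"])
      (use eA eB low high in auto)
  then obtain c where c: "cell2 K m n c" "cup e (n + m) c \<noteq> 0"
    using hemi2_nonzero[of m m n n K "cup e (n + m)"] by auto
  have close: "dist (P d) (P c) \<le> 1 / real K" if "facet2 d c" "cell2 K m n c" for d c
  proof -
    have "dist (P d) (P c) \<le> 1 / (2 * real K)"
      using that dist_grid_point_facet[OF f, of "fst d" "fst c" K]
        dist_grid_point_facet[OF g, of "snd d" "snd c" K]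
      by (auto simp: facet2_def P_def dist_Pair_Pair cell2_def cell_def dim)
    also have "\<dots> \<le> 1 / real K"
      using \<open>K > 0\<close> by (simp add: field_simps)
    finally show ?thesis .
  qed
  show ?thesis
  proof (intro exI[of _ "fst (P c)"] exI[of _ "snd (P c)"] conjI allI impI norms c(1))
    fix j assume "j < n + m"
    then obtain d d' where "dist (P d) (P c) \<le> real (n + m) * (1 / real K)"
      "dist (P d') (P c) \<le> real (n + m) * (1 / real K)" "e j d \<noteq> e j d'"
      using cup_nonzero_close[of K m n P "1 / real K" c e "n + m" j] close c by auto
    then show "\<exists>p q. dist p (fst (P c), snd (P c)) \<le> real (n + m) / real K \<and>
        dist q (fst (P c), snd (P c)) \<le> real (n + m) / real K \<and> \<epsilon> j p \<noteq> \<epsilon> j q"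
      by (intro exI[of _ "P d"] exI[of _ "P d'"]) (auto simp: e_def)
  qed
qed

text \<open>The jumps found on finer and finer grids accumulate at one point.\<close>

theorem borsuk_ulam_product:
  fixes \<epsilon> :: "nat \<Rightarrow> 'a::euclidean_space \<times> 'b::euclidean_space \<Rightarrow> bool" and a b :: "nat \<Rightarrow> bool"
  assumes dim: "DIM('a) = Suc m" "DIM('b) = Suc n"
    and A: "\<And>j u v. j < n + m \<Longrightarrow> u \<noteq> 0 \<Longrightarrow> v \<noteq> 0 \<Longrightarrow> \<epsilon> j (- u, v) \<longleftrightarrow> \<epsilon> j (u, v) \<noteq> a j"
    and B: "\<And>j u v. j < n + m \<Longrightarrow> u \<noteq> 0 \<Longrightarrow> v \<noteq> 0 \<Longrightarrow> \<epsilon> j (u, - v) \<longleftrightarrow> \<epsilon> j (u, v) \<noteq> b j"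
    and low: "\<And>j. j < n \<Longrightarrow> b j"
    and high: "\<And>j. n \<le> j \<Longrightarrow> j < n + m \<Longrightarrow> a j \<and> \<not> b j"
  shows "\<exists>u v. u \<noteq> 0 \<and> v \<noteq> 0 \<and>
    (\<forall>j<n + m. \<forall>S. open S \<longrightarrow> (u, v) \<in> S \<longrightarrow> (\<exists>p\<in>S. \<exists>q\<in>S. \<epsilon> j p \<noteq> \<epsilon> j q))"
proof -
  \<comment> \<open>All sampled points lie in this product of shells, which is compact and keeps
    both components of a limit away from 0.\<close>
  define C where "C = (cball (0::'a) DIM('a) - ball 0 1) \<times> (cball (0::'b) DIM('b) - ball 0 1)"
  have "\<exists>x\<in>C. \<forall>j<n + m. \<exists>p q. dist p x \<le> real (n + m) / real (Suc N) \<and> dist q x \<le> real (n + m) / real (Suc N) \<and>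
      \<epsilon> j p \<noteq> \<epsilon> j q" for N
  proof -
    obtain u v where uv: "norm u \<in> {1..real DIM('a)}" "norm v \<in> {1..real DIM('b)}"
      "\<forall>j<n + m. \<exists>p q. dist p (u, v) \<le> real (n + m) / real (Suc N) \<and>
        dist q (u, v) \<le> real (n + m) / real (Suc N) \<and> \<epsilon> j p \<noteq> \<epsilon> j q"
      using borsuk_ulam_grid[of m n "Suc N" \<epsilon> a b, OF dim zero_less_Suc A B low high] by blast
    then have "(u, v) \<in> C"
      by (simp add: C_def)
    with uv(3) show ?thesis
      by blast
  qed
  then obtain x where x: "\<And>N. x N \<in> C" and
    xj: "\<And>N j. j < n + m \<Longrightarrow> \<exists>p q. dist p (x N) \<le> real (n + m) / real (Suc N) \<and>
        dist q (x N) \<le> real (n + m) / real (Suc N) \<and> \<epsilon> j p \<noteq> \<epsilon> j q"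
    unfolding Bex_def by (metis (no_types, lifting))
  have "compact C"
    unfolding C_def by (intro compact_Times compact_diff compact_cball open_ball)
  then obtain l r where l: "l \<in> C" and r: "strict_mono r" and lim: "(x \<circ> r) \<longlonglongrightarrow> l"
    using x unfolding compact_def by blast
  have lim0: "(\<lambda>N. real (n + m) / real (Suc (r N))) \<longlonglongrightarrow> 0"
    using LIMSEQ_subseq_LIMSEQ[OF LIMSEQ_Suc[OF lim_const_over_n[of "real (n + m)"]] r]
    by (simp add: comp_def)
  have "\<exists>p\<in>S. \<exists>q\<in>S. \<epsilon> j p \<noteq> \<epsilon> j q" if j: "j < n + m" and S: "open S" "l \<in> S" for j S
  proof -
    obtain \<delta> where "\<delta> > 0" and \<delta>: "ball l \<delta> \<subseteq> S"
      using S open_contains_ball by blast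
    then have "eventually (\<lambda>N. dist (x (r N)) l < \<delta> / 2) sequentially"
      "eventually (\<lambda>N. real (n + m) / real (Suc (r N)) < \<delta> / 2) sequentially"
      using tendstoD[OF lim, of "\<delta> / 2"] order_tendstoD(2)[OF lim0, of "\<delta> / 2"] by simp_all
    then obtain N where N: "dist (x (r N)) l < \<delta> / 2" "real (n + m) / real (Suc (r N)) < \<delta> / 2"
      using eventually_happens'[OF sequentially_bot eventually_conj] by blast
    obtain p q where pq: "dist p (x (r N)) \<le> real (n + m) / real (Suc (r N))"
      "dist q (x (r N)) \<le> real (n + m) / real (Suc (r N))" "\<epsilon> j p \<noteq> \<epsilon> j q"
      using xj[OF j] by blast
    have "dist p l < \<delta>" "dist q l < \<delta>"
      using pq N dist_triangle[of p l "x (r N)"] dist_triangle[of q l "x (r N)"] by linarith+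
    then have "p \<in> S" "q \<in> S"
      using \<delta> by (auto simp: dist_commute)
    then show ?thesis
      using pq(3) by blast
  qed
  moreover have "fst l \<noteq> 0" "snd l \<noteq> 0"
    using l by (auto simp: C_def)
  ultimately show ?thesis
    by (intro exI[of _ "fst l"] exI[of _ "snd l"]) simp
qed

section \<open>An even quartic under linear substitutions\<close>

lemma proj_class_eq_iff: "proj_class v = proj_class w \<longleftrightarrow> (\<exists>c. c \<noteq> 0 \<and> v = c *s w)"
proof
  assume "proj_class v = proj_class w"
  moreover have "v \<in> proj_class v"
    unfolding proj_class_def by (auto intro!: exI[of _ 1])
  ultimately show "\<exists>c. c \<noteq> 0 \<and> v = c *s w"
    by (auto simp: proj_class_def)
next
  assume "\<exists>c. c \<noteq> 0 \<and> v = c *s w"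
  then obtain c where c: "c \<noteq> 0" "v = c *s w"
    by blast
  have "\<exists>e. d *s w = e *s v \<and> e \<noteq> 0" if "d \<noteq> 0" for d
    using c that by (intro exI[of _ "d / c"]) (simp add: vector_smult_assoc)
  then show "proj_class v = proj_class w"
    using c by (auto simp: proj_class_def vector_smult_assoc)
qed

lemma proj_class_scale: "c \<noteq> 0 \<Longrightarrow> proj_class (c *s v) = proj_class v"
  by (auto simp: proj_class_eq_iff)

lemma proj_class_matrix_mult:
  fixes N :: "complex ^ 'n ^ 'm"
  shows "proj_class (N *v v) = (*v) N ` proj_class v"
  by (auto simp: proj_class_def vector_scalar_commute[symmetric] image_iff)

lemma proj_class_matrix_mult_eq_iff:
  fixes N :: "complex ^ 'n ^ 'm"
  assumes "inj ((*v) N)"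
  shows "proj_class (N *v v) = proj_class (N *v w) \<longleftrightarrow> proj_class v = proj_class w"
  using assms by (simp add: proj_class_matrix_mult inj_image_eq_iff)


lemma quartic_eval_add: "quartic_eval (F + G) x = quartic_eval F x + quartic_eval G x"
  by (simp add: quartic_eval_def distrib_right sum.distrib)

lemma quartic_eval_scale: "quartic_eval (c *s F) x = c * quartic_eval F x"
  by (simp add: quartic_eval_def sum_distrib_left mult.assoc)

section \<open>Products of linear forms as coefficient vectors\<close>

definition monomial_type :: "(nat \<Rightarrow> 3) \<Rightarrow> quartic_exponent" where
  "monomial_type f = Abs_quartic_exponent (\<lambda>i. card {k \<in> {..<4}. f k = i})"

lemma exponent_monomial_type: "exponent (monomial_type f) i = card {k \<in> {..<4}. f k = i}"
proof -
  have "(\<Sum>i\<in>UNIV. card {k \<in> {..<4::nat}. f k = i}) = 4"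
    using sum.group[of "{..<4::nat}" UNIV f "\<lambda>_. 1::nat"] by simp
  then show ?thesis
    by (simp add: monomial_type_def Abs_quartic_exponent_inverse)
qed

text \<open>Expanded by choosing the variable \<open>f k\<close> from factor \<open>k\<close>.
  Continuity and invariance under signs thus become statements about the coefficient vectors that
  \<open>proj_class\<close> sees, not merely about values.\<close>

definition linear_prod :: "(nat \<Rightarrow> complex ^ 3) \<Rightarrow> quartic" where
  "linear_prod a = (\<chi> m. \<Sum>f | f \<in> PiE {..<4} (\<lambda>_. UNIV) \<and> monomial_type f = m. \<Prod>k<4. a k $ f k)"

lemma quartic_eval_linear_prod:
  "quartic_eval (linear_prod a) x = (\<Prod>k<4. \<Sum>i\<in>UNIV. a k $ i * x $ i)"
proof -
  let ?S = "PiE {..<4::nat} (\<lambda>_. UNIV :: 3 set)"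
  have fin: "finite ?S"
    by (simp add: finite_PiE)
  have monom: "(\<Prod>k<4. x $ f k) = (\<Prod>i\<in>UNIV. x $ i ^ exponent (monomial_type f) i)" for f
  proof -
    have "(\<Prod>k<4. x $ f k) = (\<Prod>i\<in>UNIV. \<Prod>k | k \<in> {..<4} \<and> f k = i. x $ f k)"
      by (rule prod.group[symmetric]) auto
    also have "\<dots> = (\<Prod>i\<in>UNIV. \<Prod>k | k \<in> {..<4} \<and> f k = i. x $ i)"
      by (intro prod.cong refl) auto
    finally show ?thesis
      by (simp add: exponent_monomial_type)
  qed
  have "quartic_eval (linear_prod a) x =
      (\<Sum>m\<in>UNIV. \<Sum>f | f \<in> ?S \<and> monomial_type f = m. \<Prod>k<4. a k $ f k * x $ f k)"
    unfolding quartic_eval_def linear_prod_def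
    by (auto intro!: sum.cong simp: sum_distrib_right prod.distrib monom)
  also have "\<dots> = (\<Sum>f\<in>?S. \<Prod>k<4. a k $ f k * x $ f k)"
    by (rule sum.group) (use fin in auto)
  also have "\<dots> = (\<Prod>k<4. \<Sum>i\<in>UNIV. a k $ i * x $ i)"
    by (rule prod_sum_PiE[symmetric]) auto
  finally show ?thesis .
qed

lemma linear_prod_scale: "linear_prod (\<lambda>k. c k *s a k) = (\<Prod>k<4. c k) *s linear_prod a"
  by (simp add: linear_prod_def vec_eq_iff prod.distrib sum_distrib_left)

lemma continuous_linear_prod [continuous_intros]:
  assumes "\<And>k. k < 4 \<Longrightarrow> continuous_on S (a k)"
  shows "continuous_on S (\<lambda>t. linear_prod (\<lambda>k. a k t))"
  unfolding linear_prod_def using assms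
  by (intro continuous_on_vec_lambda continuous_on_sum continuous_on_prod continuous_on_component) auto


text \<open>A member of the pencil spanned by the two symmetric even quartics, chosen such that the squared
  coordinates of its flexes are Gaussian integers.\<close>

definition qf :: "complex ^ 3 \<Rightarrow> complex" where
  "qf y = 3 * ((y$1)^4 + (y$2)^4 + (y$3)^4) +
     5 * ((y$1)^2 * (y$2)^2 + (y$2)^2 * (y$3)^2 + (y$3)^2 * (y$1)^2)"

definition sqsum :: "complex ^ 3 \<Rightarrow> complex" where
  "sqsum y = (y$1)^2 + (y$2)^2 + (y$3)^2"

definition qf_grad :: "complex ^ 3 \<Rightarrow> complex ^ 3" where
  "qf_grad y = (\<chi> k. 2 * y$k * ((y$k)^2 + 5 * sqsum y))"

text \<open>Half the Hessian form.\<close>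

definition qf_hess :: "complex ^ 3 \<Rightarrow> complex ^ 3 \<Rightarrow> complex" where
  "qf_hess y w = (\<Sum>k\<in>UNIV. (13 * (y$k)^2 + 5 * sqsum y) * (w$k)^2) +
     20 * (y$1 * y$2 * w$1 * w$2 + y$2 * y$3 * w$2 * w$3 + y$3 * y$1 * w$3 * w$1)"

definition dot :: "complex ^ 3 \<Rightarrow> complex ^ 3 \<Rightarrow> complex" where
  "dot a b = (\<Sum>i\<in>UNIV. a$i * b$i)"

definition qf_pullback :: "complex ^ 3 ^ 3 \<Rightarrow> quartic" where
  "qf_pullback N = 3 *s (linear_prod (\<lambda>_. N$1) + linear_prod (\<lambda>_. N$2) + linear_prod (\<lambda>_. N$3)) +
     5 *s (linear_prod (\<lambda>k. if k < 2 then N$1 else N$2) +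
           linear_prod (\<lambda>k. if k < 2 then N$2 else N$3) +
           linear_prod (\<lambda>k. if k < 2 then N$3 else N$1))"

lemma quartic_eval_qf_pullback: "quartic_eval (qf_pullback N) x = qf (N *v x)"
  by (simp add: qf_pullback_def quartic_eval_add quartic_eval_scale quartic_eval_linear_prod
      qf_def matrix_vector_mult_def numeral_eq_Suc lessThan_Suc if_distrib power2_eq_square mult_ac)

lemma continuous_on_vector_scalar_mult [continuous_intros]:
  fixes f :: "'a::topological_space \<Rightarrow> complex ^ 'n"
  assumes "continuous_on S f"
  shows "continuous_on S (\<lambda>x. c *s f x)"
  unfolding vector_scalar_mult_def using assms by (intro continuous_intros)

lemma continuous_qf_pullback: "continuous_on UNIV qf_pullback"
proof -
  have "continuous_on UNIV (\<lambda>N :: complex ^ 3 ^ 3. if P then N $ i else N $ j)" for P i j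
    by (cases P) (auto intro!: continuous_intros)
  then show ?thesis
    unfolding qf_pullback_def by (intro continuous_intros)
qed

lemma qf_pullback_signs:
  assumes "\<And>i. c i = 1 \<or> c i = -1"
  shows "qf_pullback (\<chi> i. c i *s N$i) = qf_pullback N"
proof -
  have c: "c i ^ 4 = 1" "c i ^ 2 * c j ^ 2 = 1" for i j
    using assms[of i] assms[of j] by auto
  have "linear_prod (\<lambda>_. c i *s N$i) = linear_prod (\<lambda>_. N$i)" for i
    by (simp add: linear_prod_scale[where c = "\<lambda>_. c i" and a = "\<lambda>_. N$i"] c)
  moreover have "linear_prod (\<lambda>k. if k < 2 then c i *s N$i else c j *s N$j) =
      linear_prod (\<lambda>k. if k < 2 then N$i else N$j)" for i j
  proof -
    have "linear_prod (\<lambda>k. if k < 2 then c i *s N$i else c j *s N$j) =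
        linear_prod (\<lambda>k. (if k < 2 then c i else c j) *s (if k < 2 then N$i else N$j))"
      by (intro arg_cong[of _ _ linear_prod]) auto
    also have "\<dots> = (c i ^ 2 * c j ^ 2) *s linear_prod (\<lambda>k. if k < 2 then N$i else N$j)"
      by (simp add: linear_prod_scale numeral_eq_Suc lessThan_Suc mult_ac)
    finally show ?thesis
      by (simp add: c)
  qed
  ultimately show ?thesis
    unfolding qf_pullback_def vec_lambda_beta by (simp only:)
qed

text \<open>The Taylor expansion along a line; its cubic coefficient comes from the linear one by
  exchanging \<open>y\<close> and \<open>w\<close>.\<close>

definition qf_line_poly :: "complex ^ 3 \<Rightarrow> complex ^ 3 \<Rightarrow> complex poly" where
  "qf_line_poly y w = [:qf y, dot (qf_grad y) w, qf_hess y w, dot (qf_grad w) y, qf w:]"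

lemma poly_qf_line_poly: "poly (qf_line_poly y w) t = qf (y + t *s w)"
  unfolding qf_line_poly_def qf_def dot_def qf_grad_def qf_hess_def sqsum_def sum_3
  by simp algebra

lemma line_poly_qf_pullback: "line_poly (qf_pullback N) v w = qf_line_poly (N *v v) (N *v w)"
proof -
  have "poly (line_poly (qf_pullback N) v w) t = poly (qf_line_poly (N *v v) (N *v w)) t" for t
    by (simp add: poly_line_poly poly_qf_line_poly quartic_eval_qf_pullback
        matrix_vector_right_distrib vector_scalar_commute)
  then show ?thesis
    by (simp add: poly_eq_poly_eq_iff[symmetric] fun_eq_iff)
qed

lemma partial_deriv_qf_pullback:
  "partial_deriv (qf_pullback N) i x = (\<Sum>k\<in>UNIV. qf_grad (N *v x) $ k * N $ k $ i)"
proof -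
  have *: "x + axis i t = x + t *s axis i 1" for t
    by (simp add: vec_eq_iff axis_def)
  have "(\<lambda>t. quartic_eval (qf_pullback N) (x + axis i t)) =
      poly (qf_line_poly (N *v x) (N *v axis i 1))"
    unfolding poly_qf_line_poly quartic_eval_qf_pullback * matrix_vector_right_distrib
      vector_scalar_commute ..
  then have "partial_deriv (qf_pullback N) i x =
      poly (pderiv (qf_line_poly (N *v x) (N *v axis i 1))) 0"
    unfolding partial_deriv_def by (simp only: DERIV_imp_deriv[OF poly_DERIV])
  also have "\<dots> = dot (qf_grad (N *v x)) (N *v axis i 1)"
    by (simp add: qf_line_poly_def pderiv_pCons)
  finally show ?thesis
    by (simp add: dot_def matrix_vector_mult_def axis_def if_distrib cong: if_cong)
qed

lemma sum_partial_deriv_qf_pullback: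
  "(\<Sum>i\<in>UNIV. partial_deriv (qf_pullback N) i x * w $ i) = dot (qf_grad (N *v x)) (N *v w)"
proof -
  have "(\<Sum>i\<in>UNIV. partial_deriv (qf_pullback N) i x * w $ i) =
      (\<Sum>i\<in>UNIV. \<Sum>k\<in>UNIV. qf_grad (N *v x) $ k * (N $ k $ i * w $ i))"
    by (simp add: partial_deriv_qf_pullback sum_distrib_right mult.assoc)
  also have "\<dots> = (\<Sum>k\<in>UNIV. \<Sum>i\<in>UNIV. qf_grad (N *v x) $ k * (N $ k $ i * w $ i))"
    by (rule sum.swap)
  finally show ?thesis
    by (simp add: dot_def matrix_vector_mult_def sum_distrib_left)
qed

lemma intersection_mult_qf_pullback:
  "intersection_mult (qf_pullback N) v w \<ge> 3 \<longleftrightarrow>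
     qf (N *v v) = 0 \<and> dot (qf_grad (N *v v)) (N *v w) = 0 \<and> qf_hess (N *v v) (N *v w) = 0"
proof -
  let ?p = "qf_line_poly (N *v v) (N *v w)"
  have "intersection_mult (qf_pullback N) v w \<ge> 3 \<longleftrightarrow> ?p = 0 \<or> 3 \<le> order 0 ?p"
    by (auto simp: intersection_mult_def line_poly_qf_pullback numeral_eq_enat)
  also have "\<dots> \<longleftrightarrow> monom 1 3 dvd ?p"
    using order_divides[of 0 3 ?p] by (simp add: monom_altdef)
  also have "\<dots> \<longleftrightarrow> (\<forall>k<3. coeff ?p k = 0)"
    by (rule monom_1_dvd_iff')
  finally show ?thesis
    by (auto simp: qf_line_poly_def numeral_eq_Suc All_less_Suc)
qed

definition qf_flex :: "complex ^ 3 \<Rightarrow> bool" where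
  "qf_flex y \<longleftrightarrow> y \<noteq> 0 \<and> qf y = 0 \<and> qf_grad y \<noteq> 0 \<and>
     (\<exists>w. w \<noteq> 0 \<and> proj_class w \<noteq> proj_class y \<and> dot (qf_grad y) w = 0 \<and> qf_hess y w = 0)"

text \<open>Gradient and contact order are those of \<open>qf\<close> at the image point, and
  \<open>N\<close> is onto, so every direction at the image has the form
  \<open>N *v w\<close>.\<close>

lemma is_inflection_qf_pullback:
  assumes "invertible N"
  shows "is_inflection (qf_pullback N) v \<longleftrightarrow> qf_flex (N *v v)"
proof -
  obtain M where M: "N ** M = mat 1" "M ** N = mat 1"
    using assms by (auto simp: invertible_def)
  have NM: "N *v (M *v x) = x" and MN: "M *v (N *v x) = x" for x
    using M by (simp_all add: matrix_vector_mul_assoc)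
  have inj: "inj ((*v) N)"
    using MN by (rule inj_on_inverseI)
  have zero: "N *v x = 0 \<longleftrightarrow> x = 0" for x
    using MN[of x] by (auto simp: matrix_vector_mult_0_right)
  have "(\<exists>i. partial_deriv (qf_pullback N) i v \<noteq> 0) \<longleftrightarrow> qf_grad (N *v v) \<noteq> 0"
  proof
    assume "qf_grad (N *v v) \<noteq> 0"
    then obtain k where k: "qf_grad (N *v v) $ k \<noteq> 0"
      by (auto simp: vec_eq_iff)
    have "dot (qf_grad (N *v v)) (N *v (M *v axis k 1)) = qf_grad (N *v v) $ k"
      by (simp add: NM dot_def axis_def if_distrib cong: if_cong)
    then have "(\<Sum>i\<in>UNIV. partial_deriv (qf_pullback N) i v * (M *v axis k 1) $ i) \<noteq> 0"
      using k by (simp add: sum_partial_deriv_qf_pullback)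
    then show "\<exists>i. partial_deriv (qf_pullback N) i v \<noteq> 0"
      by (metis (no_types, lifting) mult_zero_left sum.neutral)
  qed (auto simp: partial_deriv_qf_pullback)
  moreover have ex: "(\<exists>w. P w) \<longleftrightarrow> (\<exists>w. P (N *v w))" for P
    using NM by metis
  ultimately show ?thesis
    unfolding is_inflection_def qf_flex_def zero quartic_eval_qf_pullback
      sum_partial_deriv_qf_pullback intersection_mult_qf_pullback
    by (subst ex) (auto simp: zero proj_class_matrix_mult_eq_iff[OF inj])
qed

lemma qf_pullback_nonzero: "is_inflection F v \<Longrightarrow> F \<noteq> 0"
  by (auto simp: is_inflection_def partial_deriv_def quartic_eval_def)

lemma card_inflection_points_qf_pullback:
  assumes "invertible N"
  shows "card (inflection_points (qf_pullback N)) = card (proj_class ` {y. qf_flex y})"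
proof -
  obtain M where M: "N ** M = mat 1" "M ** N = mat 1"
    using assms by (auto simp: invertible_def)
  have NM: "N *v (M *v x) = x" and MN: "M *v (N *v x) = x" for x
    using M by (simp_all add: matrix_vector_mul_assoc)
  have "inj ((*v) M)"
    using NM by (rule inj_on_inverseI)
  then have "inj_on ((`) ((*v) M)) A" for A
    by (simp add: inj_on_def inj_image_eq_iff)
  moreover have "inflection_points (qf_pullback N) = (`) ((*v) M) ` proj_class ` {y. qf_flex y}"
  proof -
    have "{v. is_inflection (qf_pullback N) v} = (*v) M ` {y. qf_flex y}"
      unfolding is_inflection_qf_pullback[OF assms]
    proof (intro equalityI subsetI)
      fix x assume "x \<in> {v. qf_flex (N *v v)}"
      then show "x \<in> (*v) M ` {y. qf_flex y}"
        using MN[of x] by (intro image_eqI[of _ _ "N *v x"]) auto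
    qed (auto simp: NM)
    then show ?thesis
      unfolding inflection_points_def by (simp add: image_image proj_class_matrix_mult)
  qed
  ultimately show ?thesis
    by (simp add: card_image)
qed

section \<open>The flexes of the even quartic\<close>

text \<open>The classical relation between the bordered Hessian and the Hessian determinant, which modulo
  the quartic is a multiple of \<open>y3\<^sup>2 c\<close>.\<close>

lemma hess_identity:
  fixes y1 y2 y3 :: complex
  assumes E: "E = y1^2 + y2^2 + y3^2" and c: "c = y1^2 * y2^2 * y3^2 + 5 * E^3"
    and "3 * (y1^4 + y2^4 + y3^4) + 5 * (y1^2 * y2^2 + y2^2 * y3^2 + y3^2 * y1^2) = 0"
  shows "(13 * y1^2 + 5 * E) * (2 * y2 * (y2^2 + 5 * E))^2 +
      (13 * y2^2 + 5 * E) * (2 * y1 * (y1^2 + 5 * E))^2 -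
      20 * y1 * y2 * (2 * y1 * (y1^2 + 5 * E)) * (2 * y2 * (y2^2 + 5 * E)) =
    - (132 * y3^2 * c)" (is "?l = ?r")
proof -
  \<comment> \<open>By Euler's relations \<open>9 * ?l\<close> is \<open>24 * qf\<close> times a 2
    by 2 minor of the half Hessian minus \<open>4 * y3^2\<close> times its determinant. In the
    elementary symmetric functions of the squares the determinant is
    \<open>297 e3 + 345 E e2 + 450 E^3\<close>; with \<open>e2 = 3 E^2 - qf\<close> it becomes
    \<open>297 c - 345 E qf\<close>. Hence \<open>132 = 4 * 297 / 9\<close> and
    \<open>1380 = 4 * 345\<close>.\<close>
  have "9 * ?l = (3 * (y1^4 + y2^4 + y3^4) + 5 * (y1^2 * y2^2 + y2^2 * y3^2 + y3^2 * y1^2)) *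
      (24 * (13 * y1^2 + 5 * E) * (13 * y2^2 + 5 * E) - 2400 * y1^2 * y2^2 + 1380 * y3^2 * E) + 9 * ?r"
    unfolding E c by algebra
  then have "9 * ?l = 9 * ?r"
    unfolding assms(3) mult_zero_left add_0 .
  then show ?thesis
    by (rule mult_left_cancel[THEN iffD1, rotated]) simp
qed

text \<open>The arguments are the cross products of the gradient with the unit vectors: where the
  tangent line meets the coordinate lines.\<close>

lemma qf_hess_kernel:
  assumes "qf y = 0"
  defines "c \<equiv> (y$1)^2 * (y$2)^2 * (y$3)^2 + 5 * sqsum y ^ 3"
  shows "qf_hess y (vector [qf_grad y $ 2, - qf_grad y $ 1, 0]) = - (132 * (y$3)^2 * c)"
    and "qf_hess y (vector [0, qf_grad y $ 3, - qf_grad y $ 2]) = - (132 * (y$1)^2 * c)"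
    and "qf_hess y (vector [- qf_grad y $ 3, 0, qf_grad y $ 1]) = - (132 * (y$2)^2 * c)"
proof -
  have Q: "3 * ((y$1)^4 + (y$2)^4 + (y$3)^4) +
      5 * ((y$1)^2 * (y$2)^2 + (y$2)^2 * (y$3)^2 + (y$3)^2 * (y$1)^2) = 0"
    using assms(1) by (simp add: qf_def)
  have h3: "qf_hess y (vector [b, - a, 0]) =
      (13 * (y$1)^2 + 5 * sqsum y) * b^2 + (13 * (y$2)^2 + 5 * sqsum y) * a^2 - 20 * y$1 * y$2 * a * b" for a b
    unfolding qf_hess_def sum_3 vector_3 by simp
  show "qf_hess y (vector [qf_grad y $ 2, - qf_grad y $ 1, 0]) = - (132 * (y$3)^2 * c)"
    unfolding h3 qf_grad_def vec_lambda_beta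
    by (rule hess_identity) (use Q in \<open>simp_all add: sqsum_def c_def ac_simps\<close>)
  have h1: "qf_hess y (vector [0, b, - a]) =
      (13 * (y$2)^2 + 5 * sqsum y) * b^2 + (13 * (y$3)^2 + 5 * sqsum y) * a^2 - 20 * y$2 * y$3 * a * b" for a b
    unfolding qf_hess_def sum_3 vector_3 by simp
  show "qf_hess y (vector [0, qf_grad y $ 3, - qf_grad y $ 2]) = - (132 * (y$1)^2 * c)"
    unfolding h1 qf_grad_def vec_lambda_beta
    by (rule hess_identity) (use Q in \<open>simp_all add: sqsum_def c_def ac_simps\<close>)
  have h2: "qf_hess y (vector [- a, 0, b]) =
      (13 * (y$3)^2 + 5 * sqsum y) * b^2 + (13 * (y$1)^2 + 5 * sqsum y) * a^2 - 20 * y$3 * y$1 * a * b" for a b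
    unfolding qf_hess_def sum_3 vector_3 by simp
  show "qf_hess y (vector [- qf_grad y $ 3, 0, qf_grad y $ 1]) = - (132 * (y$2)^2 * c)"
    unfolding h2 qf_grad_def vec_lambda_beta
    by (rule hess_identity) (use Q in \<open>simp_all add: sqsum_def c_def ac_simps\<close>)
qed

lemma vec3_eqI: "x$1 = y$1 \<Longrightarrow> x$2 = y$2 \<Longrightarrow> x$3 = y$3 \<Longrightarrow> x = (y :: 'a ^ 3)"
  by (simp add: vec_eq_iff forall_3)

lemma qf_hess_scale: "qf_hess y (c *s w) = c^2 * qf_hess y w"
  unfolding qf_hess_def sum_3 vector_smult_component by algebra

text \<open>Euler's relations; at a flex they make the Hessian form vanish on the whole span of
  \<open>y\<close> and \<open>w\<close>.\<close>

lemma qf_hess_combination: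
  "qf_hess y (a *s w - b *s y) = a^2 * qf_hess y w - 3 * a * b * dot (qf_grad y) w + 6 * b^2 * qf y"
  unfolding qf_hess_def sum_3 vector_smult_component vector_minus_component qf_grad_def dot_def
    qf_def sqsum_def vec_lambda_beta
  by algebra

lemma dot_qf_grad_self: "dot (qf_grad y) y = 4 * qf y"
  unfolding sum_3 qf_grad_def dot_def qf_def sqsum_def vec_lambda_beta by algebra

definition ccross :: "complex ^ 3 \<Rightarrow> complex ^ 3 \<Rightarrow> complex ^ 3" where
  "ccross a b = vector [a$2 * b$3 - a$3 * b$2, a$3 * b$1 - a$1 * b$3, a$1 * b$2 - a$2 * b$1]"

lemma ccross_eq_0:
  assumes "ccross a b = 0" "a \<noteq> 0"
  shows "\<exists>c. b = c *s a"
proof -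
  have e: "a$2 * b$3 = a$3 * b$2" "a$3 * b$1 = a$1 * b$3" "a$1 * b$2 = a$2 * b$1"
    using assms(1) by (simp_all add: ccross_def vec_eq_iff forall_3)
  have "a$1 \<noteq> 0 \<or> a$2 \<noteq> 0 \<or> a$3 \<noteq> 0"
    using assms(2) by (auto simp: vec_eq_iff forall_3)
  then consider "a$1 \<noteq> 0" | "a$2 \<noteq> 0" | "a$3 \<noteq> 0"
    by blast
  then show ?thesis
  proof cases
    case 1
    then show ?thesis
      using e by (intro exI[of _ "b$1 / a$1"] vec3_eqI) (simp_all add: field_simps)
  next
    case 2
    then show ?thesis
      using e by (intro exI[of _ "b$2 / a$2"] vec3_eqI) (simp_all add: field_simps)
  next
    case 3
    then show ?thesis
      using e by (intro exI[of _ "b$3 / a$3"] vec3_eqI) (simp_all add: field_simps)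
  qed
qed

text \<open>The span of \<open>y\<close> and \<open>w\<close> is the kernel of the gradient, so it
  contains the three vectors of \<open>qf_hess_kernel\<close>. The Hessian form vanishes there, and
  some coordinate of \<open>y\<close> is nonzero.\<close>

lemma qf_flex_equation:
  assumes "qf_flex y"
  shows "(y$1)^2 * (y$2)^2 * (y$3)^2 + 5 * sqsum y ^ 3 = 0"
proof -
  define g where "g = qf_grad y"
  obtain w where y: "y \<noteq> 0" "qf y = 0" "g \<noteq> 0" and w: "w \<noteq> 0" "proj_class w \<noteq> proj_class y"
    "dot g w = 0" "qf_hess y w = 0"
    using assms by (auto simp: qf_flex_def g_def)
  define c where "c = ccross y w"
  have "c \<noteq> 0"
  proof
    assume "c = 0"
    then obtain a where "w = a *s y"
      using ccross_eq_0 y(1) by (auto simp: c_def)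
    then show False
      using w(1,2) by (auto simp: proj_class_eq_iff)
  qed
  then have "c$1 \<noteq> 0 \<or> c$2 \<noteq> 0 \<or> c$3 \<noteq> 0"
    by (auto simp: vec_eq_iff forall_3)
  have gy: "dot g y = 0"
    using y(2) by (simp add: g_def dot_qf_grad_self)
  \<comment> \<open>Both \<open>g\<close> and \<open>c\<close> annihilate the independent vectors
    \<open>y\<close> and \<open>w\<close>, so they are proportional.\<close>
  have cg: "c$1 * g$2 = c$2 * g$1" "c$2 * g$3 = c$3 * g$2" "c$3 * g$1 = c$1 * g$3"
    using gy w(3) unfolding c_def ccross_def vector_3 dot_def sum_3 by algebra+
  obtain \<kappa> where g: "g = \<kappa> *s c"
  proof -
    have "ccross c g = 0"
      using cg by (intro vec3_eqI) (simp_all add: ccross_def)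
    then show thesis
      using ccross_eq_0 \<open>c \<noteq> 0\<close> that by blast
  qed
  have comb: "qf_hess y (a *s w - b *s y) = 0" for a b
    using y(2) w(3,4) by (simp add: qf_hess_combination flip: g_def)
  have k3: "qf_hess y (vector [g$2, - g$1, 0]) = 0"
  proof -
    \<comment> \<open>The cross product of \<open>g\<close> with the third unit vector, by the
      triple product identity.\<close>
    have "vector [g$2, - g$1, 0] = \<kappa> *s (y$3 *s w - w$3 *s y)"
      by (intro vec3_eqI) (simp_all add: g c_def ccross_def algebra_simps)
    then show ?thesis
      by (simp only: qf_hess_scale comb mult_zero_right)
  qed
  have k1: "qf_hess y (vector [0, g$3, - g$2]) = 0"
  proof -
    have "vector [0, g$3, - g$2] = \<kappa> *s (y$1 *s w - w$1 *s y)"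
      by (intro vec3_eqI) (simp_all add: g c_def ccross_def algebra_simps)
    then show ?thesis
      by (simp only: qf_hess_scale comb mult_zero_right)
  qed
  have k2: "qf_hess y (vector [- g$3, 0, g$1]) = 0"
  proof -
    have "vector [- g$3, 0, g$1] = \<kappa> *s (y$2 *s w - w$2 *s y)"
      by (intro vec3_eqI) (simp_all add: g c_def ccross_def algebra_simps)
    then show ?thesis
      by (simp only: qf_hess_scale comb mult_zero_right)
  qed
  have "(y$k)^2 * ((y$1)^2 * (y$2)^2 * (y$3)^2 + 5 * sqsum y ^ 3) = 0" if "k \<in> {1, 2, 3}" for k
    using qf_hess_kernel[OF y(2)] k1 k2 k3 that by (auto simp flip: g_def)
  moreover have "y$1 \<noteq> 0 \<or> y$2 \<noteq> 0 \<or> y$3 \<noteq> 0"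
    using y(1) by (auto simp: vec_eq_iff forall_3)
  ultimately show ?thesis
    by (auto simp: exhaust_3)
qed

text \<open>The squares of the homogeneous coordinates of a flex are proportional to the roots
  of \<open>T\<^sup>3 - T\<^sup>2 + 3 T + 5\<close>.\<close>

definition flex_squares :: "(complex \<times> complex \<times> complex) set" where
  "flex_squares = (let a = - 1; b = 1 + 2 * \<i>; c = 1 - 2 * \<i> in
     {(a, b, c), (a, c, b), (b, a, c), (b, c, a), (c, a, b), (c, b, a)})"

definition squares :: "complex ^ 3 \<Rightarrow> complex \<times> complex \<times> complex" where
  "squares y = ((y$1)^2, (y$2)^2, (y$3)^2)"

lemma card_flex_squares: "card flex_squares = 6"
proof -
  have "- 1 \<noteq> 1 + 2 * \<i>" "- 1 \<noteq> 1 - 2 * \<i>" "1 + 2 * \<i> \<noteq> 1 - 2 * \<i>"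
    by (simp_all add: complex_eq_iff)
  then show ?thesis
    by (simp add: flex_squares_def Let_def)
qed

lemma flex_squares_symmetric:
  assumes "(X, Y, Z) \<in> flex_squares"
  shows "X + Y + Z = 1" "X * Y + Y * Z + Z * X = 3" "X * Y * Z = - 5"
  using assms by (auto simp: flex_squares_def Let_def complex_eq_iff)

lemma flex_squares_nonzero:
  assumes "(X, Y, Z) \<in> flex_squares"
  shows "X \<noteq> 0" "Y \<noteq> 0" "Z \<noteq> 0" "X + 5 \<noteq> 0" "Y + 5 \<noteq> 0" "Z + 5 \<noteq> 0"
  using assms by (auto simp: flex_squares_def Let_def complex_eq_iff)

lemma flex_squares_iff:
  assumes "X + Y + Z = 1" "X * Y + Y * Z + Z * X = 3" "X * Y * Z = - 5"
  shows "(X, Y, Z) \<in> flex_squares"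
proof -
  have root: "T \<in> {- 1, 1 + 2 * \<i>, 1 - 2 * \<i>}" if "T^3 - T^2 + 3 * T + 5 = 0" for T
  proof -
    have "(T + 1) * (T - (1 + 2 * \<i>)) * (T - (1 - 2 * \<i>)) = T^3 - T^2 + 3 * T + 5"
      by (simp add: algebra_simps power2_eq_square power3_eq_cube)
    then have "T + 1 = 0 \<or> T - (1 + 2 * \<i>) = 0 \<or> T - (1 - 2 * \<i>) = 0"
      unfolding that mult_eq_0_iff by blast
    then show ?thesis
      unfolding right_minus_eq insert_iff eq_neg_iff_add_eq_0 by blast
  qed
  have "X^3 - X^2 + 3 * X + 5 = 0" "Y^3 - Y^2 + 3 * Y + 5 = 0" "Z^3 - Z^2 + 3 * Z + 5 = 0"
    using assms by algebra+
  then have "X \<in> {- 1, 1 + 2 * \<i>, 1 - 2 * \<i>}" "Y \<in> {- 1, 1 + 2 * \<i>, 1 - 2 * \<i>}"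
    using root by blast+
  moreover have "Z = 1 - X - Y"
    using assms(1) by algebra
  moreover have "X \<noteq> Y"
  proof
    assume "X = Y"
    then have "X * X + X * (1 - X - X) + (1 - X - X) * X = 3"
      using assms(2) \<open>Z = 1 - X - Y\<close> by simp
    then show False
      using \<open>X \<in> _\<close> by (auto simp: complex_eq_iff)
  qed
  ultimately show ?thesis
    by (elim insertE emptyE) (simp_all add: flex_squares_def Let_def)
qed

lemma qf_eq_sqsum:
  "qf y = 3 * sqsum y ^ 2 - ((y$1)^2 * (y$2)^2 + (y$2)^2 * (y$3)^2 + (y$3)^2 * (y$1)^2)"
  unfolding qf_def sqsum_def by algebra

text \<open>The sum of the squares is nonzero, since otherwise all their symmetric functions vanish.
  Scaled to 1, it fixes the other two symmetric functions.\<close>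

lemma qf_flex_imp_squares:
  assumes "qf_flex y"
  shows "\<exists>c. c \<noteq> 0 \<and> squares (c *s y) \<in> flex_squares"
proof -
  define X Y Z where "X = (y$1)^2" and "Y = (y$2)^2" and "Z = (y$3)^2"
  define E where "E = X + Y + Z"
  have E: "sqsum y = E"
    by (simp add: sqsum_def E_def X_def Y_def Z_def)
  have e2: "X * Y + Y * Z + Z * X = 3 * E^2" and e3: "X * Y * Z = - 5 * E^3"
    using assms qf_eq_sqsum[of y] qf_flex_equation[OF assms]
    by (simp_all add: qf_flex_def E X_def Y_def Z_def eq_neg_iff_add_eq_0)
  have "E \<noteq> 0"
  proof
    assume "E = 0"
    then have "X^3 = 0" "Y^3 = 0" "Z^3 = 0"
      using e2 e3 E_def by algebra+
    then have "y = 0"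
      by (simp add: X_def Y_def Z_def vec_eq_iff forall_3)
    then show False
      using assms by (simp add: qf_flex_def)
  qed
  define c where "c = csqrt (1 / E)"
  have c: "c^2 = 1 / E" "c \<noteq> 0"
    using \<open>E \<noteq> 0\<close> by (auto simp: c_def)
  have "(X / E, Y / E, Z / E) \<in> flex_squares"
  proof (rule flex_squares_iff)
    show "X / E + Y / E + Z / E = 1"
      using \<open>E \<noteq> 0\<close> by (simp add: E_def flip: add_divide_distrib)
    have "X / E * (Y / E) + Y / E * (Z / E) + Z / E * (X / E) = (X * Y + Y * Z + Z * X) / E^2"
      by (simp add: power2_eq_square flip: add_divide_distrib)
    then show "X / E * (Y / E) + Y / E * (Z / E) + Z / E * (X / E) = 3"
      using \<open>E \<noteq> 0\<close> by (simp add: e2)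
    have "X / E * (Y / E) * (Z / E) = (X * Y * Z) / E^3"
      by (simp add: power3_eq_cube)
    then show "X / E * (Y / E) * (Z / E) = - 5"
      using \<open>E \<noteq> 0\<close> by (simp add: e3)
  qed
  then have "squares (c *s y) \<in> flex_squares"
    using c by (simp add: squares_def power_mult_distrib X_def Y_def Z_def)
  then show ?thesis
    using c(2) by blast
qed

lemma squares_imp_qf_flex:
  assumes "squares y \<in> flex_squares"
  shows "qf_flex y"
proof -
  define g where "g = qf_grad y"
  note sq = assms[unfolded squares_def]
  have E: "sqsum y = 1"
    using flex_squares_symmetric(1)[OF sq] by (simp add: sqsum_def)
  have qf: "qf y = 0"
    using flex_squares_symmetric(2)[OF sq] by (simp add: qf_eq_sqsum E)
  have y: "y$1 \<noteq> 0" "y$2 \<noteq> 0" "y$3 \<noteq> 0"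
    using flex_squares_nonzero[OF sq] by auto
  have g: "g$1 \<noteq> 0" "g$2 \<noteq> 0"
    using y flex_squares_nonzero[OF sq] by (simp_all add: g_def qf_grad_def E)
  \<comment> \<open>A tangent vector with third coordinate 0; as \<open>y$3\<close> is nonzero, it
    is not proportional to \<open>y\<close>.\<close>
  define w :: "complex ^ 3" where "w = vector [g$2, - g$1, 0]"
  have "qf_hess y w = 0"
    using qf_hess_kernel(1)[OF qf] flex_squares_symmetric(3)[OF sq]
    by (simp add: w_def g_def E)
  moreover have "dot g w = 0"
    by (simp add: dot_def w_def sum_3)
  moreover have "w \<noteq> 0"
    using g by (auto simp: w_def vec_eq_iff forall_3)
  moreover have "proj_class w \<noteq> proj_class y"
  proof
    assume "proj_class w = proj_class y"
    then obtain c where "c \<noteq> 0" "w = c *s y"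
      by (auto simp: proj_class_eq_iff)
    then have "w$3 \<noteq> 0"
      using y by simp
    then show False
      by (simp add: w_def)
  qed
  moreover have "y \<noteq> 0" "g \<noteq> 0"
    using y g by auto
  ultimately show ?thesis
    using qf by (auto simp: qf_flex_def g_def)
qed

text \<open>Six ordered triples of squares times four sign choices; the common sign is used up by
  making the third coordinate a principal root.\<close>

lemma card_qf_flexes: "card (proj_class ` {y. qf_flex y}) = 24"
proof -
  define h :: "(complex \<times> complex \<times> complex) \<times> complex \<times> complex \<Rightarrow> complex ^ 3" where
    "h = (\<lambda>((X, Y, Z), s, t). vector [s * csqrt X, t * csqrt Y, csqrt Z])"
  define S where "S = flex_squares \<times> {1, - 1 :: complex} \<times> {1, - 1 :: complex}"
  have sq: "squares (h (p, s, t)) = p" if "(p, s, t) \<in> S" for p s t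
    using that by (cases p) (auto simp: S_def h_def squares_def power_mult_distrib)
  have "proj_class ` {y. qf_flex y} = (\<lambda>x. proj_class (h x)) ` S"
  proof (intro equalityI subsetI)
    fix q assume "q \<in> (\<lambda>x. proj_class (h x)) ` S"
    then obtain p s t where "(p, s, t) \<in> S" "q = proj_class (h (p, s, t))"
      by auto
    moreover from this have "qf_flex (h (p, s, t))"
      by (intro squares_imp_qf_flex) (auto simp: sq S_def)
    ultimately show "q \<in> proj_class ` {y. qf_flex y}"
      by blast
  next
    fix q assume "q \<in> proj_class ` {y. qf_flex y}"
    then obtain y where y: "qf_flex y" "q = proj_class y"
      by blast
    obtain c where c: "c \<noteq> 0" "squares (c *s y) \<in> flex_squares"
      using qf_flex_imp_squares[OF y(1)] by blast
    have root: "x = csqrt (x^2) \<or> x = - csqrt (x^2)" for x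
      using power2_csqrt[of "x^2"] by (metis power2_eq_iff)
    obtain e where e: "e \<in> {1, - 1}" "(c * y$3) = e * csqrt ((c * y$3)^2)"
      using root[of "c * y$3"] that[of 1] that[of "- 1"] by auto
    define z where "z = (e * c) *s y"
    have "e^2 = 1"
      using e(1) by auto
    then have "squares z = squares (c *s y)"
      by (simp add: z_def squares_def power_mult_distrib)
    then have zsq: "squares z \<in> flex_squares"
      using c by simp
    have z3: "z$3 = csqrt ((z$3)^2)"
    proof -
      have "z$3 = e^2 * csqrt ((c * y$3)^2)"
        using e(2) by (simp add: z_def power2_eq_square mult.assoc)
      also have "(c * y$3)^2 = (z$3)^2"
        using \<open>e^2 = 1\<close> by (simp add: z_def power_mult_distrib)
      finally show ?thesis
        using \<open>e^2 = 1\<close> by simp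
    qed
    obtain s where s: "s \<in> {1, - 1}" "z$1 = s * csqrt ((z$1)^2)"
      using root[of "z$1"] that[of 1] that[of "- 1"] by auto
    obtain t where t: "t \<in> {1, - 1}" "z$2 = t * csqrt ((z$2)^2)"
      using root[of "z$2"] that[of 1] that[of "- 1"] by auto
    have "z = h (squares z, s, t)"
      using s(2) t(2) z3 by (intro vec3_eqI) (simp_all add: h_def squares_def)
    moreover have "(squares z, s, t) \<in> S"
      unfolding S_def by (intro SigmaI zsq s(1) t(1))
    moreover have "q = proj_class z"
      using y(2) c(1) e(1) proj_class_scale[of "e * c" y] by (auto simp: z_def)
    ultimately show "q \<in> (\<lambda>x. proj_class (h x)) ` S"
      by (metis imageI)
  qed
  moreover have "inj_on (\<lambda>x. proj_class (h x)) S"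
  proof (rule inj_onI)
    fix x x' assume x: "x \<in> S" "x' \<in> S" and eq: "proj_class (h x) = proj_class (h x')"
    obtain X Y Z s t where xe: "x = ((X, Y, Z), s, t)"
      by (metis prod.exhaust)
    obtain X' Y' Z' s' t' where xe': "x' = ((X', Y', Z'), s', t')"
      by (metis prod.exhaust)
    have p: "(X, Y, Z) \<in> flex_squares" "(X', Y', Z') \<in> flex_squares"
      using x by (auto simp: S_def xe xe')
    obtain c where c: "h x = c *s h x'"
      using eq by (auto simp: proj_class_eq_iff)
    have "squares (h x) = (X, Y, Z)" "squares (h x') = (X', Y', Z')"
      using sq x by (simp_all add: xe xe')
    then have c2: "X = c^2 * X'" "Y = c^2 * Y'" "Z = c^2 * Z'"
      by (simp_all add: c squares_def power_mult_distrib)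
    \<comment> \<open>Both triples of squares have sum 1, so \<open>c\<close> is 1 or -1; comparing
      third coordinates excludes -1.\<close>
    have "c^2 * (X' + Y' + Z') = X + Y + Z"
      by (simp add: c2 algebra_simps)
    then have "c^2 = 1"
      using flex_squares_symmetric(1)[OF p(1)] flex_squares_symmetric(1)[OF p(2)] by simp
    then have same: "X = X'" "Y = Y'" "Z = Z'"
      using c2 by simp_all
    have nz: "csqrt X \<noteq> 0" "csqrt Y \<noteq> 0" "csqrt Z \<noteq> 0"
      using flex_squares_nonzero[OF p(1)] by simp_all
    have "h x $ 3 = c * h x' $ 3" "h x $ 1 = c * h x' $ 1" "h x $ 2 = c * h x' $ 2"
      by (simp_all add: c)
    then have "c = 1" "s = c * s'" "t = c * t'"
      using nz by (simp_all add: h_def xe xe' same)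
    then show "x = x'"
      by (simp add: xe xe' same)
  qed
  ultimately have "card (proj_class ` {y. qf_flex y}) = card S"
    by (simp add: card_image)
  also have "\<dots> = 24"
    by (simp add: S_def card_cartesian_product card_flex_squares)
  finally show ?thesis .
qed

section \<open>Sections of the covering\<close>

definition representative :: "(complex ^ 'n) set \<Rightarrow> complex ^ 'n" where
  "representative q = (SOME z. z \<in> q)"

lemma representative_proj_class: "\<exists>c. c \<noteq> 0 \<and> representative (proj_class z) = c *s z"
proof -
  have "z \<in> proj_class z"
    by (auto simp: proj_class_def intro!: exI[of _ 1])
  then have "representative (proj_class z) \<in> proj_class z"
    unfolding representative_def by (rule someI)
  then show ?thesis
    by (auto simp: proj_class_def)
qed

lemma openin_proj_class_image:
  assumes "open A" "0 \<notin> A" "\<And>c v. c \<noteq> 0 \<Longrightarrow> v \<in> A \<Longrightarrow> c *s v \<in> A"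
  shows "openin proj_space (proj_class ` A)"
proof -
  have "{v. v \<noteq> 0 \<and> proj_class v \<in> proj_class ` A} = A"
    using assms(2,3) by (auto simp: proj_class_eq_iff)
  then show ?thesis
    using assms(1,2) by (auto simp: openin_proj_space)
qed

text \<open>Division by a nonzero \<open>l\<close>-th coordinate does not depend on the
  representative. Open sets of this chart are images of open cones, so continuity into the quotient
  topology becomes continuity of vectors.\<close>

lemma proj_space_local_lift:
  fixes \<sigma> :: "'a::topological_space \<Rightarrow> (complex ^ 'n) set"
  assumes cont: "continuous_map (top_of_set W) proj_space \<sigma>" and "open W" "x0 \<in> W"
  shows "\<exists>S \<zeta>. open S \<and> x0 \<in> S \<and> S \<subseteq> W \<and> continuous_on S \<zeta> \<and> (\<forall>x\<in>S. \<sigma> x = proj_class (\<zeta> x))"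
proof -
  have "\<sigma> x0 \<in> topspace proj_space"
    using cont \<open>x0 \<in> W\<close> by (auto simp: continuous_map_def)
  then obtain z0 where z0: "z0 \<noteq> 0" "\<sigma> x0 = proj_class z0"
    by (auto simp: topspace_proj_space)
  then obtain l where l: "z0 $ l \<noteq> 0"
    by (auto simp: vec_eq_iff)
  define chart where "chart V = {z :: complex ^ 'n. z $ l \<noteq> 0 \<and> (1 / z $ l) *s z \<in> V}" for V
  have open_preimage: "open {x \<in> W. \<sigma> x \<in> proj_class ` chart V}" if "open V" for V
  proof -
    have ne: "open {z :: complex ^ 'n. z $ l \<noteq> 0}"
      by (intro open_Collect_neq continuous_intros)
    have "continuous_on {z :: complex ^ 'n. z $ l \<noteq> 0} (\<lambda>z. (1 / z $ l) *s z)"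
      unfolding vector_scalar_mult_def by (intro continuous_intros) auto
    then have "open ((\<lambda>z. (1 / z $ l) *s z) -` V \<inter> {z :: complex ^ 'n. z $ l \<noteq> 0})"
      using ne that by (simp add: continuous_on_open_vimage)
    moreover have "(\<lambda>z. (1 / z $ l) *s z) -` V \<inter> {z :: complex ^ 'n. z $ l \<noteq> 0} = chart V"
      by (auto simp: chart_def)
    ultimately have "open (chart V)"
      by simp
    then have "openin proj_space (proj_class ` chart V)"
      by (rule openin_proj_class_image) (auto simp: chart_def vector_smult_assoc)
    then have "openin (top_of_set W) {x \<in> W. \<sigma> x \<in> proj_class ` chart V}"
      using openin_continuous_map_preimage[OF cont] by simp
    then show ?thesis
      using \<open>open W\<close> openin_open_trans by blast
  qed
  define S where "S = {x \<in> W. \<sigma> x \<in> proj_class ` chart UNIV}"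
  define \<zeta> where "\<zeta> x = (1 / representative (\<sigma> x) $ l) *s representative (\<sigma> x)" for x
  have \<zeta>: "\<zeta> x = (1 / z $ l) *s z" if "\<sigma> x = proj_class z" for x z
  proof -
    obtain c where "c \<noteq> 0" "representative (\<sigma> x) = c *s z"
      using representative_proj_class[of z] \<open>\<sigma> x = proj_class z\<close> by auto
    then show ?thesis
      by (simp add: \<zeta>_def vector_smult_assoc)
  qed
  have S: "open S"
    unfolding S_def by (rule open_preimage) simp
  moreover have "x0 \<in> S"
    using \<open>x0 \<in> W\<close> z0 l unfolding S_def chart_def by blast
  moreover have "continuous_on S \<zeta>"
    unfolding continuous_on_open_vimage[OF S]
  proof (intro allI impI)
    fix V :: "(complex ^ 'n) set" assume "open V"
    have "\<zeta> -` V \<inter> S = {x \<in> W. \<sigma> x \<in> proj_class ` chart V}"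
    proof (intro equalityI subsetI)
      fix x assume "x \<in> \<zeta> -` V \<inter> S"
      then obtain z where z: "\<zeta> x \<in> V" "x \<in> W" "z $ l \<noteq> 0" "\<sigma> x = proj_class z"
        unfolding S_def chart_def by blast
      then have "z \<in> chart V"
        using \<zeta>[OF z(4)] by (simp add: chart_def)
      then show "x \<in> {x \<in> W. \<sigma> x \<in> proj_class ` chart V}"
        using z by blast
    next
      fix x assume "x \<in> {x \<in> W. \<sigma> x \<in> proj_class ` chart V}"
      then obtain z where z: "x \<in> W" "z $ l \<noteq> 0" "(1 / z $ l) *s z \<in> V" "\<sigma> x = proj_class z"
        unfolding chart_def by blast
      then have "\<zeta> x \<in> V" "z \<in> chart UNIV"
        using \<zeta>[OF z(4)] by (simp_all add: chart_def)
      then show "x \<in> \<zeta> -` V \<inter> S"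
        using z unfolding S_def by blast
    qed
    then show "open (\<zeta> -` V \<inter> S)"
      using open_preimage[OF \<open>open V\<close>] by simp
  qed
  moreover have "\<sigma> x = proj_class (\<zeta> x)" if x: "x \<in> S" for x
  proof -
    obtain z where z: "\<sigma> x = proj_class z" "z $ l \<noteq> 0"
      using x unfolding S_def chart_def by blast
    then have "proj_class (\<zeta> x) = proj_class z"
      unfolding \<zeta>[OF z(1)] by (intro proj_class_scale) simp
    then show ?thesis
      using z(1) by simp
  qed
  moreover have "S \<subseteq> W"
    by (auto simp: S_def)
  ultimately show ?thesis
    by blast
qed

text \<open>For orthonormal \<open>u\<close>, \<open>v\<close> these are exactly the matrices in \<open>SU(3)\<close>; independence of \<open>u\<close>, \<open>v\<close>
  suffices for invertibility.\<close>

definition frame :: "(complex ^ 3) \<times> (complex ^ 3) \<Rightarrow> complex ^ 3 ^ 3" where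
  "frame x = vector [fst x, snd x, \<chi> i. cnj (ccross (fst x) (snd x) $ i)]"

text \<open>Open among all pairs, unlike the orthonormal pairs, so that local constancy can be
  tested on open sets of the ambient space as in \<open>borsuk_ulam_product\<close>.\<close>

definition indep :: "((complex ^ 3) \<times> (complex ^ 3)) set" where
  "indep = {x. ccross (fst x) (snd x) \<noteq> 0}"

lemma continuous_ccross: "continuous_on UNIV (\<lambda>x. ccross (fst x) (snd x))"
proof -
  have "continuous_on UNIV (\<lambda>x. ccross (fst x) (snd x) $ i)" for i
    using exhaust_3[of i]
    by (elim disjE) (simp_all add: ccross_def, (intro continuous_intros)+)
  then have "continuous_on UNIV (\<lambda>x. \<chi> i. ccross (fst x) (snd x) $ i)"
    by (rule continuous_on_vec_lambda)
  then show ?thesis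
    by simp
qed

lemma open_indep: "open indep"
  unfolding indep_def by (intro open_Collect_neq continuous_ccross continuous_intros)

lemma continuous_frame: "continuous_on UNIV frame"
proof -
  have "continuous_on UNIV (\<lambda>x. frame x $ i)" for i
    using exhaust_3[of i]
    by (elim disjE) (simp_all add: frame_def, (intro continuous_intros continuous_ccross)+)
  then have "continuous_on UNIV (\<lambda>x. \<chi> i. frame x $ i)"
    by (rule continuous_on_vec_lambda)
  then show ?thesis
    by simp
qed

text \<open>A vector killed by the first two rows is a multiple \<open>a\<close> of their cross
  product \<open>c\<close>, and the third row maps it to \<open>a\<close> times the squared norm of
  \<open>c\<close>.\<close>

lemma invertible_frame:
  assumes "x \<in> indep"
  shows "invertible (frame x)"
proof -
  define c where "c = ccross (fst x) (snd x)"
  have c: "c \<noteq> 0"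
    using assms by (simp add: indep_def c_def)
  have "z = 0" if z: "frame x *v z = 0" for z
  proof -
    have rows: "dot (fst x) z = 0" "dot (snd x) z = 0" "(\<Sum>i\<in>UNIV. cnj (c $ i) * z $ i) = 0"
    proof -
      have "(frame x *v z) $ i = 0" for i
        using z by simp
      from this[of 1] this[of 2] this[of 3]
      show "dot (fst x) z = 0" "dot (snd x) z = 0" "(\<Sum>i\<in>UNIV. cnj (c $ i) * z $ i) = 0"
        by (simp_all add: matrix_vector_mult_def frame_def dot_def c_def)
    qed
    have "ccross c z = 0"
      using rows(1,2) unfolding c_def ccross_def dot_def sum_3
      by (intro vec3_eqI) (simp only: vector_3 zero_index, algebra)+
    then obtain a where a: "z = a *s c"
      using ccross_eq_0 c by blast
    have "(\<Sum>i\<in>UNIV. cnj (c $ i) * z $ i) = a * of_real (\<Sum>i\<in>UNIV. (norm (c $ i))^2)"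
      by (simp add: a sum_distrib_left complex_norm_square mult_ac del: of_real_power)
    moreover have "(\<Sum>i\<in>UNIV. (norm (c $ i))^2) \<noteq> 0"
      using c by (auto simp: sum_nonneg_eq_0_iff vec_eq_iff)
    ultimately show "z = 0"
      using rows(3) a by (simp del: of_real_sum)
  qed
  then obtain B where "B ** frame x = mat 1"
    using matrix_left_invertible_ker[of "frame x"] by blast
  then show ?thesis
    using matrix_left_right_inverse invertible_def by blast
qed

text \<open>The third row changes sign with either vector, which produces the sign matrices of
  determinant 1.\<close>

lemma frame_uminus:
  "frame (- u, v) = (\<chi> i. vector [- 1, 1, - 1] $ i *s frame (u, v) $ i)"
  "frame (u, - v) = (\<chi> i. vector [1, - 1, - 1] $ i *s frame (u, v) $ i)"
  by (simp_all add: frame_def ccross_def vec_eq_iff forall_3)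

section \<open>The orbit map into the base of the covering\<close>

definition quartic_of :: "(complex ^ 3) \<times> (complex ^ 3) \<Rightarrow> quartic set" where
  "quartic_of x = proj_class (qf_pullback (frame x))"

lemma sign_vector:
  "vector [- 1, 1, - 1 :: complex] $ (i :: 3) = 1 \<or> vector [- 1, 1, - 1 :: complex] $ i = - 1"
  "vector [1, - 1, - 1 :: complex] $ (i :: 3) = 1 \<or> vector [1, - 1, - 1 :: complex] $ i = - 1"
  using exhaust_3[of i] by auto

lemma quartic_of_uminus:
  "quartic_of (- u, v) = quartic_of (u, v)" "quartic_of (u, - v) = quartic_of (u, v)"
  unfolding quartic_of_def frame_uminus by (simp_all only: qf_pullback_signs sign_vector)

lemma indep_uminus: "(- u, v) \<in> indep \<longleftrightarrow> (u, v) \<in> indep" "(u, - v) \<in> indep \<longleftrightarrow> (u, v) \<in> indep"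
  by (auto simp: indep_def ccross_def vec_eq_iff forall_3)

lemma card_inflection_points_frame:
  "x \<in> indep \<Longrightarrow> card (inflection_points (qf_pullback (frame x))) = 24"
  by (simp add: card_inflection_points_qf_pullback invertible_frame card_qf_flexes)

lemma qf_pullback_frame_nonzero:
  assumes "x \<in> indep"
  shows "qf_pullback (frame x) \<noteq> 0"
proof -
  have "inflection_points (qf_pullback (frame x)) \<noteq> {}"
    using card_inflection_points_frame[OF assms] by auto
  then show ?thesis
    using qf_pullback_nonzero by (auto simp: inflection_points_def)
qed

lemma quartic_of_in_B_flex: "x \<in> indep \<Longrightarrow> quartic_of x \<in> B_flex"
  unfolding quartic_of_def B_flex_def
  using card_inflection_points_frame qf_pullback_frame_nonzero by blast

lemma continuous_quartic_of: "continuous_map (top_of_set indep) B_flex_top quartic_of"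
proof -
  have "continuous_on indep (\<lambda>x. qf_pullback (frame x))"
    using continuous_on_compose2[OF continuous_qf_pullback continuous_frame] continuous_on_subset
    by blast
  then have "continuous_map (top_of_set indep) (top_of_set (- {0})) (\<lambda>x. qf_pullback (frame x))"
    using qf_pullback_frame_nonzero by auto
  then have "continuous_map (top_of_set indep) proj_space (proj_class \<circ> (\<lambda>x. qf_pullback (frame x)))"
    by (rule continuous_map_compose) (rule quotient_imp_continuous_map[OF quotient_map_proj_class])
  then show ?thesis
    unfolding B_flex_top_def continuous_map_in_subtopology
    using quartic_of_in_B_flex by (auto simp: comp_def quartic_of_def[abs_def])
qed

lemma topspace_B_flex_top: "topspace B_flex_top = B_flex"
  by (auto simp: B_flex_top_def topspace_proj_space B_flex_def)

section \<open>Signs selected by a section\<close>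

definition half_plane :: "complex \<Rightarrow> bool" where
  "half_plane z \<longleftrightarrow> Re z > 0 \<or> Re z = 0 \<and> Im z > 0"

lemma half_plane_uminus: "z \<noteq> 0 \<Longrightarrow> half_plane (- z) \<longleftrightarrow> \<not> half_plane z"
  by (auto simp: half_plane_def complex_eq_iff)

text \<open>Homogeneous of degree 0; changing signs of the coordinates of \<open>y\<close> multiplies it by the product
  of the signs at \<open>j\<close> and \<open>k\<close>.\<close>

definition coord_ratio :: "3 \<Rightarrow> 3 \<Rightarrow> complex ^ 3 \<Rightarrow> complex" where
  "coord_ratio j k y = y$j * y$k / (y$1)^2"

lemma coord_ratio_scale: "c \<noteq> 0 \<Longrightarrow> coord_ratio j k (c *s y) = coord_ratio j k y"
  by (simp add: coord_ratio_def power2_eq_square)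

lemma qf_flex_coord_nonzero:
  assumes "qf_flex y"
  shows "y $ i \<noteq> 0"
proof -
  obtain c where "squares (c *s y) \<in> flex_squares"
    using qf_flex_imp_squares assms by blast
  then show ?thesis
    using flex_squares_nonzero(1-3)[of "(c * y$1)^2" "(c * y$2)^2" "(c * y$3)^2"] exhaust_3[of i]
    by (auto simp: squares_def)
qed

text \<open>The squared ratio depends only on the six triples of squares. Finiteness makes a
  continuously varying ratio locally constant.\<close>

lemma finite_coord_ratio: "finite (coord_ratio j k ` {y. qf_flex y})"
proof -
  define R where "R = (\<lambda>(X, Y, Z). let s = (\<lambda>i::3. if i = 1 then X else if i = 2 then Y else Z)
    in s j * s k / X^2) ` flex_squares"
  have "finite R"
    by (simp add: R_def flex_squares_def Let_def)
  have "coord_ratio j k ` {y. qf_flex y} \<subseteq> csqrt ` R \<union> (\<lambda>r. - csqrt r) ` R"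
  proof
    fix t assume "t \<in> coord_ratio j k ` {y. qf_flex y}"
    then obtain y where y: "qf_flex y" "t = coord_ratio j k y"
      by blast
    obtain c where c: "c \<noteq> 0" "squares (c *s y) \<in> flex_squares"
      using qf_flex_imp_squares[OF y(1)] by blast
    have "t = coord_ratio j k (c *s y)"
      using c y by (simp add: coord_ratio_scale)
    then have "t^2 \<in> R"
      unfolding R_def using c(2) exhaust_3[of j] exhaust_3[of k]
      by (intro image_eqI[of _ _ "squares (c *s y)"])
        (auto simp: squares_def coord_ratio_def Let_def power_mult_distrib power_divide)
    moreover have "t = csqrt (t^2) \<or> t = - csqrt (t^2)"
      using power2_csqrt[of "t^2"] by (metis power2_eq_iff)
    ultimately show "t \<in> csqrt ` R \<union> (\<lambda>r. - csqrt r) ` R"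
      by blast
  qed
  then show ?thesis
    using \<open>finite R\<close> finite_subset by blast
qed

text \<open>\<open>frame x\<close> carries the flex selected over \<open>quartic_of x\<close> to a
  flex of the fixed quartic. Its coordinate ratio is continuous with finitely many values, all
  nonzero, and \<open>\<tau>\<close> records the half plane of this ratio.\<close>

lemma section_sign:
  fixes j k :: 3
  assumes U: "openin B_flex_top U" and s: "continuous_map (subtopology B_flex_top U) E_flex_top s"
    and sec: "\<And>b. b \<in> U \<Longrightarrow> fst (s b) = b"
  defines "W \<equiv> {x \<in> indep. quartic_of x \<in> U}"
  shows "\<exists>\<tau>. (\<forall>x\<in>W. \<exists>S. open S \<and> x \<in> S \<and> S \<subseteq> W \<and> (\<forall>y\<in>S. \<tau> y = \<tau> x)) \<and>
    (\<forall>x\<in>W. \<forall>x'\<in>W. \<forall>c. quartic_of x' = quartic_of x \<longrightarrow> frame x' = (\<chi> i. c i *s frame x $ i) \<longrightarrow>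
      (\<forall>i. c i = 1 \<or> c i = - 1) \<longrightarrow> \<tau> x' = (\<tau> x \<noteq> (c j * c k = - 1)))"
proof -
  \<comment> \<open>Position 0 of the ordering: one continuously chosen flex already carries the
    sign.\<close>
  define \<sigma> where "\<sigma> x = snd (s (quartic_of x)) 0" for x
  define T where "T x = coord_ratio j k (frame x *v representative (\<sigma> x))" for x
  have "openin (top_of_set indep) W"
    using openin_continuous_map_preimage[OF continuous_quartic_of U] by (simp add: W_def)
  then have "open W"
    using open_indep openin_open_trans by blast
  have cont: "continuous_map (top_of_set W) proj_space \<sigma>"
  proof -
    have "W \<subseteq> indep"
      by (auto simp: W_def)
    then have "continuous_map (top_of_set W) (subtopology B_flex_top U) quartic_of"
      using continuous_map_from_subtopology_mono[OF continuous_quartic_of, of W]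
      by (auto simp: continuous_map_in_subtopology W_def)
    then have "continuous_map (top_of_set W) E_flex_top (s \<circ> quartic_of)"
      using s by (rule continuous_map_compose)
    then have "continuous_map (top_of_set W) (product_topology (\<lambda>_. proj_space) {..<24})
        (snd \<circ> (s \<circ> quartic_of))"
      unfolding E_flex_top_def by (rule continuous_map_compose) (rule continuous_map_subtopology_snd)
    then have "continuous_map (top_of_set W) proj_space ((\<lambda>p. p 0) \<circ> (snd \<circ> (s \<circ> quartic_of)))"
      by (rule continuous_map_compose) (rule continuous_map_product_projection, simp)
    then show ?thesis
      by (simp add: \<sigma>_def[abs_def] comp_def)
  qed
  have flex: "\<exists>z. \<sigma> x = proj_class z \<and> qf_flex (frame x *v z)" if "x \<in> W" for x
  proof -
    have x: "x \<in> indep" "quartic_of x \<in> U"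
      using that by (auto simp: W_def)
    have "U \<subseteq> topspace B_flex_top"
      using U by (rule openin_subset)
    then have "s (quartic_of x) \<in> topspace E_flex_top"
      using s x(2) by (auto simp: continuous_map_def)
    then have "s (quartic_of x) \<in> E_flex"
      by (simp add: E_flex_top_def)
    then obtain F p where F: "s (quartic_of x) = (proj_class F, p)" "bij_betw p {..<24} (inflection_points F)"
      unfolding E_flex_def by blast
    have "proj_class F = proj_class (qf_pullback (frame x))"
      using sec[OF x(2)] F(1) by (simp add: quartic_of_def)
    then obtain c where "c \<noteq> 0" "F = c *s qf_pullback (frame x)"
      by (auto simp: proj_class_eq_iff)
    then have "inflection_points F = inflection_points (qf_pullback (frame x))"
      by (simp add: inflection_points_scale)
    then have "p 0 \<in> inflection_points (qf_pullback (frame x))"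
      using bij_betwE[OF F(2)] by auto
    then show ?thesis
      using F(1) is_inflection_qf_pullback[OF invertible_frame[OF x(1)]]
      by (auto simp: inflection_points_def \<sigma>_def)
  qed
  have T: "T x = coord_ratio j k (frame x *v z)" "(frame x *v z) $ 1 \<noteq> 0"
    if x: "x \<in> W" and z: "\<sigma> x = proj_class z" for x z
  proof -
    obtain c where "c \<noteq> 0" "representative (\<sigma> x) = c *s z"
      using representative_proj_class[of z] z by auto
    then show "T x = coord_ratio j k (frame x *v z)"
      by (simp add: T_def vector_scalar_commute coord_ratio_scale)
    obtain z' where z': "\<sigma> x = proj_class z'" "qf_flex (frame x *v z')"
      using flex x by blast
    then obtain e where "e \<noteq> 0" "z = e *s z'"
      using z by (auto simp: proj_class_eq_iff)
    then show "(frame x *v z) $ 1 \<noteq> 0"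
      using qf_flex_coord_nonzero[OF z'(2), of 1] by (simp add: vector_scalar_commute)
  qed
  have T_in: "T x \<in> coord_ratio j k ` {y. qf_flex y}" if x: "x \<in> W" for x
  proof -
    obtain z where "\<sigma> x = proj_class z" "qf_flex (frame x *v z)"
      using flex x by blast
    with T(1)[OF x, of z] show ?thesis
      by simp
  qed
  have T_nonzero: "T x \<noteq> 0" if x: "x \<in> W" for x
  proof -
    obtain y where "qf_flex y" "T x = coord_ratio j k y"
      using T_in[OF x] by blast
    then show ?thesis
      using qf_flex_coord_nonzero[of y] by (simp add: coord_ratio_def)
  qed
  have local: "\<exists>S. open S \<and> x0 \<in> S \<and> S \<subseteq> W \<and> (\<forall>x\<in>S. half_plane (T x) = half_plane (T x0))" if x0: "x0 \<in> W" for x0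
  proof -
    obtain S \<zeta> where S: "open S" "x0 \<in> S" "S \<subseteq> W" "continuous_on S \<zeta>"
      "\<And>x. x \<in> S \<Longrightarrow> \<sigma> x = proj_class (\<zeta> x)"
      using proj_space_local_lift[OF cont \<open>open W\<close> x0] by blast
    have comp: "continuous_on S (\<lambda>x. (frame x *v \<zeta> x) $ i)" for i
      unfolding matrix_vector_mult_def vec_lambda_beta
      by (intro continuous_intros S(4) continuous_on_subset[OF continuous_frame]) auto
    have T_\<zeta>: "T x = coord_ratio j k (frame x *v \<zeta> x)" "(frame x *v \<zeta> x) $ 1 \<noteq> 0" if "x \<in> S" for x
      using T[OF subsetD[OF S(3) that] S(5)[OF that]] .
    have "continuous_on S (\<lambda>x. coord_ratio j k (frame x *v \<zeta> x))"
      unfolding coord_ratio_def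
      by (intro continuous_on_divide continuous_on_mult continuous_on_power comp) (simp add: T_\<zeta>(2))
    moreover have "continuous_on S T \<longleftrightarrow> continuous_on S (\<lambda>x. coord_ratio j k (frame x *v \<zeta> x))"
      by (intro continuous_on_cong refl T_\<zeta>(1))
    ultimately have contT: "continuous_on S T"
      by blast
    \<comment> \<open>Avoiding the finitely many other values leaves an open set on which
      \<open>T\<close> is constant.\<close>
    define S' where "S' = T -` (- (coord_ratio j k ` {y. qf_flex y} - {T x0})) \<inter> S"
    have "closed (coord_ratio j k ` {y. qf_flex y} - {T x0})"
      by (intro finite_imp_closed finite_Diff finite_coord_ratio)
    then have "open (- (coord_ratio j k ` {y. qf_flex y} - {T x0}))"
      by (rule open_Compl)
    then have open_S': "open S'"
      unfolding S'_def by (rule contT[unfolded continuous_on_open_vimage[OF S(1)], rule_format])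
    have T_eq: "T x = T x0" if "x \<in> S'" for x
    proof -
      have "x \<in> S" "T x \<notin> coord_ratio j k ` {y. qf_flex y} - {T x0}"
        using that unfolding S'_def by blast+
      moreover from this have "T x \<in> coord_ratio j k ` {y. qf_flex y}"
        using S(3) by (intro T_in) (rule subsetD)
      ultimately show ?thesis
        by simp
    qed
    show ?thesis
    proof (intro exI[of _ S'] conjI ballI)
      show "x0 \<in> S'"
        using S(2) by (simp add: S'_def)
      show "S' \<subseteq> W"
        using S(3) unfolding S'_def by (rule subset_trans[OF Int_lower2])
    qed (simp_all only: open_S' T_eq)
  qed
  have equivariant: "half_plane (T x') = (half_plane (T x) \<noteq> (c j * c k = - 1))"
    if "x \<in> W" "x' \<in> W" "quartic_of x' = quartic_of x" and fr: "frame x' = (\<chi> i. c i *s frame x $ i)"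
      and c: "\<And>i. c i = 1 \<or> c i = - 1" for x x' c
  proof -
    have "(frame x' *v z) $ i = c i * (frame x *v z) $ i" for z i
      by (simp add: fr matrix_vector_mult_def sum_distrib_left mult.assoc)
    \<comment> \<open>The section sees only the point of the base, so the flex stays while the frame
      changes its signs.\<close>
    moreover have "\<sigma> x' = \<sigma> x"
      using that(3) by (simp add: \<sigma>_def)
    moreover have "(c 1)^2 = 1"
      using c[of 1] by auto
    ultimately have "T x' = (c j * c k) * T x"
      unfolding T_def coord_ratio_def by (simp add: power_mult_distrib)
    moreover have "c j * c k = 1 \<or> c j * c k = - 1"
      using c[of j] c[of k] by auto
    ultimately show ?thesis
      using half_plane_uminus[OF T_nonzero[OF that(1)]] by auto
  qed
  show ?thesis
  proof (intro exI[of _ "\<lambda>x. half_plane (T x)"] conjI ballI allI impI)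
    fix x assume "x \<in> W"
    then show "\<exists>S. open S \<and> x \<in> S \<and> S \<subseteq> W \<and> (\<forall>y\<in>S. half_plane (T y) = half_plane (T x))"
      by (rule local)
  next
    fix x x' c
    assume "x \<in> W" "x' \<in> W" "quartic_of x' = quartic_of x" "frame x' = (\<chi> i. c i *s frame x $ i)"
      "\<forall>i. c i = 1 \<or> c i = - 1"
    then show "half_plane (T x') = (half_plane (T x) \<noteq> (c j * c k = - 1))"
      by (intro equivariant) auto
  qed
qed

section \<open>Eight sections against the Hermitian product\<close>

definition positive_vec :: "complex ^ 3 \<Rightarrow> bool" where
  "positive_vec u \<longleftrightarrow>
     half_plane (if u$1 \<noteq> 0 then u$1 else if u$2 \<noteq> 0 then u$2 else u$3)"

lemma positive_vec_uminus: "u \<noteq> 0 \<Longrightarrow> positive_vec (- u) \<longleftrightarrow> \<not> positive_vec u"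
  by (auto simp: positive_vec_def half_plane_uminus vec_eq_iff forall_3)

definition herm :: "(complex ^ 3) \<times> (complex ^ 3) \<Rightarrow> complex" where
  "herm x = (\<Sum>i\<in>UNIV. fst x $ i * cnj (snd x $ i))"

lemma continuous_herm: "continuous_on UNIV herm"
  unfolding herm_def by (intro continuous_intros)

lemma herm_uminus: "herm (- u, v) = - herm (u, v)" "herm (u, - v) = - herm (u, v)"
  by (simp_all add: herm_def sum_negf)

lemma herm_eq_0_imp_indep:
  assumes "herm (u, v) = 0" "u \<noteq> 0" "v \<noteq> 0"
  shows "(u, v) \<in> indep"
proof -
  have "ccross u v \<noteq> 0"
  proof
    assume "ccross u v = 0"
    then obtain c where v: "v = c *s u"
      using ccross_eq_0 assms(2) by blast
    have "herm (u, v) = cnj c * of_real (\<Sum>i\<in>UNIV. (norm (u $ i))^2)"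
      by (simp add: herm_def v sum_distrib_left complex_norm_square mult_ac del: of_real_power)
    moreover have "(\<Sum>i\<in>UNIV. (norm (u $ i))^2) \<noteq> 0"
      using assms(2) by (auto simp: sum_nonneg_eq_0_iff vec_eq_iff)
    ultimately have "c = 0"
      using assms(1) by (simp del: of_real_sum)
    then show False
      using v assms(3) by simp
  qed
  then show ?thesis
    by (simp add: indep_def)
qed

text \<open>If eight open sets with sections covered the base, their pullbacks to pairs of independent
  vectors, together with the real and imaginary parts of the Hermitian product, would give ten
  sign functions without a common jump.\<close>

lemma no_eight_sections:
  assumes op: "\<And>l :: nat. openin B_flex_top (U l)"
    and sect: "\<And>l. \<exists>s. continuous_map (subtopology B_flex_top (U l)) E_flex_top s \<and> (\<forall>b\<in>U l. fst (s b) = b)"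
  shows "\<not> B_flex \<subseteq> (\<Union>l<8. U l)"
proof
  assume cover: "B_flex \<subseteq> (\<Union>l<8. U l)"
  define W where "W l = {x \<in> indep. quartic_of x \<in> U l}" for l
  \<comment> \<open>\<open>(- u, v)\<close> changes the signs of rows 1 and 3,
    \<open>(u, - v)\<close> those of rows 2 and 3. So \<open>c 1 * c 3\<close> is the character
    \<open>\<beta>\<close>, taken for three sections, and \<open>c 2 * c 3\<close> is
    \<open>\<alpha>\<close>, taken for the other five.\<close>
  define jj :: "nat \<Rightarrow> 3" where "jj l = (if l < 3 then 1 else 2)" for l
  define sign_on where "sign_on l \<tau> \<longleftrightarrow>
    (\<forall>x\<in>W l. \<exists>S. open S \<and> x \<in> S \<and> S \<subseteq> W l \<and> (\<forall>y\<in>S. \<tau> y = \<tau> x)) \<and>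
    (\<forall>x\<in>W l. \<forall>x'\<in>W l. \<forall>c. quartic_of x' = quartic_of x \<longrightarrow> frame x' = (\<chi> i. c i *s frame x $ i) \<longrightarrow>
      (\<forall>i. c i = 1 \<or> c i = - 1) \<longrightarrow> \<tau> x' = (\<tau> x \<noteq> (c (jj l) * c 3 = - 1)))" for l \<tau>
  have "\<exists>\<tau>. sign_on l \<tau>" for l
  proof -
    obtain s where "continuous_map (subtopology B_flex_top (U l)) E_flex_top s" "\<forall>b\<in>U l. fst (s b) = b"
      using sect by blast
    then show ?thesis
      unfolding sign_on_def W_def by (intro section_sign op) auto
  qed
  then obtain \<tau> where \<tau>: "\<And>l. sign_on l (\<tau> l)"
    by metis
  have local: "\<exists>S. open S \<and> x \<in> S \<and> S \<subseteq> W l \<and> (\<forall>y\<in>S. \<tau> l y = \<tau> l x)" if "x \<in> W l" for l x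
    using \<tau>[of l] that unfolding sign_on_def by (elim conjE) (rule bspec)
  have equiv: "\<tau> l x' = (\<tau> l x \<noteq> (c (jj l) * c 3 = - 1))"
    if "x \<in> W l" "x' \<in> W l" "quartic_of x' = quartic_of x" "frame x' = (\<chi> i. c i *s frame x $ i)"
      "\<And>i. c i = 1 \<or> c i = - 1" for l x x' c
    using conjunct2[OF \<tau>[of l, unfolded sign_on_def], rule_format, OF that] .
  have W_uminus: "(- u, v) \<in> W l \<longleftrightarrow> (u, v) \<in> W l" "(u, - v) \<in> W l \<longleftrightarrow> (u, v) \<in> W l" for u v l
    by (simp_all add: W_def indep_uminus quartic_of_uminus)
  have \<tau>A: "\<tau> l (- u, v) = (\<tau> l (u, v) \<noteq> (\<not> l < 3))" if "(u, v) \<in> W l" for l u v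
    using equiv[OF that W_uminus(1)[THEN iffD2, OF that] quartic_of_uminus(1) frame_uminus(1) sign_vector(1)]
    by (simp add: jj_def)
  have \<tau>B: "\<tau> l (u, - v) = (\<tau> l (u, v) \<noteq> (l < 3))" if "(u, v) \<in> W l" for l u v
    using equiv[OF that W_uminus(2)[THEN iffD2, OF that] quartic_of_uminus(2) frame_uminus(2) sign_vector(2)]
    by (simp add: jj_def)
  \<comment> \<open>\<open>positive_vec\<close> is odd but discontinuous; as a default at
    \<open>r = 0\<close> this combination keeps the type \<open>\<alpha> + \<beta>\<close>.\<close>
  define sgn_herm where "sgn_herm r x \<longleftrightarrow>
    (if r \<noteq> 0 then r > 0 else positive_vec (fst x) \<noteq> positive_vec (snd x))"
    for r :: real and x
  \<comment> \<open>Outside \<open>W l\<close> the default has the same character as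
    \<open>\<tau> l\<close>; jumps at the border of \<open>W l\<close> do no harm.\<close>
  define sgn_sec where "sgn_sec l x \<longleftrightarrow>
    (if x \<in> W l then \<tau> l x else positive_vec (if l < 3 then snd x else fst x))" for l x
  \<comment> \<open>\<open>borsuk_ulam_product\<close> wants five factors containing
    \<open>\<beta>\<close> first, here three sections and the two Hermitian signs, and then five
    factors \<open>\<alpha>\<close>; hence the shift by 2.\<close>
  define \<epsilon> where "\<epsilon> j x = (if j = 3 then sgn_herm (Re (herm x)) x else if j = 4 then sgn_herm (Im (herm x)) x
    else sgn_sec (if j < 3 then j else j - 2) x)" for j :: nat and x
  have flips: "(\<epsilon> j (- u, v) \<longleftrightarrow> \<epsilon> j (u, v) \<noteq> (\<not> j < 3)) \<and> (\<epsilon> j (u, - v) \<longleftrightarrow> \<epsilon> j (u, v) \<noteq> (j < 5))"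
    if nz: "u \<noteq> 0" "v \<noteq> 0" for j u v
  proof -
    have h: "sgn_herm (- r) (- u, v) \<longleftrightarrow> \<not> sgn_herm r (u, v)"
      "sgn_herm (- r) (u, - v) \<longleftrightarrow> \<not> sgn_herm r (u, v)" for r
      by (auto simp: sgn_herm_def positive_vec_uminus nz)
    have s: "sgn_sec l (- u, v) \<longleftrightarrow> sgn_sec l (u, v) \<noteq> (\<not> l < 3)"
      "sgn_sec l (u, - v) \<longleftrightarrow> sgn_sec l (u, v) \<noteq> (l < 3)" for l
    proof -
      show "sgn_sec l (- u, v) \<longleftrightarrow> sgn_sec l (u, v) \<noteq> (\<not> l < 3)"
        by (cases "(u, v) \<in> W l"; cases "l < 3")
          (simp_all add: sgn_sec_def W_uminus \<tau>A positive_vec_uminus nz)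
      show "sgn_sec l (u, - v) \<longleftrightarrow> sgn_sec l (u, v) \<noteq> (l < 3)"
        by (cases "(u, v) \<in> W l"; cases "l < 3")
          (simp_all add: sgn_sec_def W_uminus \<tau>B positive_vec_uminus nz)
    qed
    consider "j < 3" | "j = 3" | "j = 4" | "j \<ge> 5"
      by linarith
    then show ?thesis
    proof cases
      case 1
      then have "\<epsilon> j = sgn_sec j"
        by (simp add: \<epsilon>_def fun_eq_iff)
      then show ?thesis
        using 1 s[of j] by simp
    next
      case 2
      then have "\<epsilon> j = (\<lambda>x. sgn_herm (Re (herm x)) x)"
        by (simp add: \<epsilon>_def fun_eq_iff)
      then show ?thesis
        using 2 h[of "Re (herm (u, v))"] by (simp add: herm_uminus)
    next
      case 3
      then have "\<epsilon> j = (\<lambda>x. sgn_herm (Im (herm x)) x)"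
        by (simp add: \<epsilon>_def fun_eq_iff)
      then show ?thesis
        using 3 h[of "Im (herm (u, v))"] by (simp add: herm_uminus)
    next
      case 4
      then have "\<epsilon> j = sgn_sec (j - 2)"
        by (simp add: \<epsilon>_def fun_eq_iff)
      moreover have "\<not> j - 2 < 3" "\<not> j < 3" "\<not> j < 5"
        using 4 by linarith+
      ultimately show ?thesis
        using s[of "j - 2"] by simp
    qed
  qed
  have "\<exists>u v. u \<noteq> 0 \<and> v \<noteq> 0 \<and>
    (\<forall>j<5 + 5. \<forall>S. open S \<longrightarrow> (u, v) \<in> S \<longrightarrow> (\<exists>p\<in>S. \<exists>q\<in>S. \<epsilon> j p \<noteq> \<epsilon> j q))"
    by (rule borsuk_ulam_product[where a = "\<lambda>j. \<not> j < 3" and b = "\<lambda>j. j < 5"])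
      (use flips in simp_all)
  then obtain u v where uv: "u \<noteq> 0" "v \<noteq> 0" and
    "\<forall>j<5 + 5. \<forall>S. open S \<longrightarrow> (u, v) \<in> S \<longrightarrow> (\<exists>p\<in>S. \<exists>q\<in>S. \<epsilon> j p \<noteq> \<epsilon> j q)"
    by (elim exE conjE)
  then have jump: "\<exists>p\<in>S. \<exists>q\<in>S. \<epsilon> j p \<noteq> \<epsilon> j q" if "j < 10" "open S" "(u, v) \<in> S" for j S
    using that by simp
  have no_jump: False if "j < 10" "open S" "(u, v) \<in> S" "\<And>x. x \<in> S \<Longrightarrow> \<epsilon> j x = e" for j S e
    using jump[OF that(1-3)] that(4) by blast
  \<comment> \<open>A nonzero real part keeps its sign nearby, so function 3 would not jump.\<close>
  have re: "Re (herm (u, v)) = 0"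
  proof (rule ccontr)
    assume "Re (herm (u, v)) \<noteq> 0"
    then consider "Re (herm (u, v)) > 0" | "Re (herm (u, v)) < 0"
      by linarith
    then show False
    proof cases
      case 1
      have "open {x. Re (herm x) > 0}"
        by (intro open_Collect_less continuous_intros continuous_herm)
      then show False
        using 1 by (intro no_jump[of 3 _ True]) (auto simp: \<epsilon>_def sgn_herm_def)
    next
      case 2
      have "open {x. Re (herm x) < 0}"
        by (intro open_Collect_less continuous_intros continuous_herm)
      then show False
        using 2 by (intro no_jump[of 3 _ False]) (auto simp: \<epsilon>_def sgn_herm_def)
    qed
  qed
  have im: "Im (herm (u, v)) = 0"
  proof (rule ccontr)
    assume "Im (herm (u, v)) \<noteq> 0"
    then consider "Im (herm (u, v)) > 0" | "Im (herm (u, v)) < 0"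
      by linarith
    then show False
    proof cases
      case 1
      have "open {x. Im (herm x) > 0}"
        by (intro open_Collect_less continuous_intros continuous_herm)
      then show False
        using 1 by (intro no_jump[of 4 _ True]) (auto simp: \<epsilon>_def sgn_herm_def)
    next
      case 2
      have "open {x. Im (herm x) < 0}"
        by (intro open_Collect_less continuous_intros continuous_herm)
      then show False
        using 2 by (intro no_jump[of 4 _ False]) (auto simp: \<epsilon>_def sgn_herm_def)
    qed
  qed
  \<comment> \<open>The common jump is an orthogonal pair, so its quartic lies in the base and in
    some \<open>U l\<close>; but near such a pair \<open>\<tau> l\<close> is constant.\<close>
  have "(u, v) \<in> indep"
    using re im uv by (intro herm_eq_0_imp_indep) (auto simp: complex_eq_iff)
  moreover from this obtain l where l: "l < 8" "quartic_of (u, v) \<in> U l"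
    using cover quartic_of_in_B_flex by blast
  ultimately have uvW: "(u, v) \<in> W l"
    by (simp add: W_def)
  define e where "e = \<tau> l (u, v)"
  obtain S where S: "open S" "(u, v) \<in> S" "S \<subseteq> W l" "\<forall>y\<in>S. \<tau> l y = e"
    using local[OF uvW] unfolding e_def by (elim exE conjE)
  define j where "j = (if l < 3 then l else l + 2)"
  have j: "j < 10" "\<epsilon> j = sgn_sec l"
    using l(1) by (auto simp: j_def \<epsilon>_def fun_eq_iff)
  have "\<epsilon> j x = e" if "x \<in> S" for x
    using subsetD[OF S(3) that] bspec[OF S(4) that] by (simp add: j(2) sgn_sec_def)
  then show False
    by (rule no_jump[OF j(1) S(1,2)])
qed

theorem theorem1p4:
  shows "schwarz_genus E_flex_top B_flex_top fst \<ge> 9"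
  unfolding schwarz_genus_def
proof (rule Inf_greatest)
  fix g assume "g \<in> {enat (card \<U>) | \<U>. finite \<U> \<and> (\<forall>U\<in>\<U>. openin B_flex_top U) \<and>
      \<Union>\<U> = topspace B_flex_top \<and>
      (\<forall>U\<in>\<U>. \<exists>s. continuous_map (subtopology B_flex_top U) E_flex_top s \<and> (\<forall>b\<in>U. fst (s b) = b))}"
  then obtain \<U> where \<U>: "g = enat (card \<U>)" "finite \<U>" "\<forall>U\<in>\<U>. openin B_flex_top U"
    "\<Union>\<U> = topspace B_flex_top"
    "\<forall>U\<in>\<U>. \<exists>s. continuous_map (subtopology B_flex_top U) E_flex_top s \<and> (\<forall>b\<in>U. fst (s b) = b)"
    by blast
  have "9 \<le> card \<U>"
  proof (rule ccontr)
    assume small: "\<not> 9 \<le> card \<U>"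
    obtain f where f: "bij_betw f {0..<card \<U>} \<U>"
      using ex_bij_betw_nat_finite[OF \<U>(2)] by blast
    \<comment> \<open>Smaller covers are padded with empty sets.\<close>
    define U where "U l = (if l < card \<U> then f l else {})" for l
    have U: "U l \<in> \<U> \<or> U l = {}" for l
      using bij_betwE[OF f] by (auto simp: U_def)
    have "openin B_flex_top (U l)" for l
      using U[of l] \<U>(3) by auto
    moreover have "\<exists>s. continuous_map (subtopology B_flex_top (U l)) E_flex_top s \<and> (\<forall>b\<in>U l. fst (s b) = b)" for l
      using U[of l] \<U>(5) by auto
    moreover have "B_flex \<subseteq> (\<Union>l<8. U l)"
    proof
      fix b assume "b \<in> B_flex"
      then obtain V where "V \<in> \<U>" "b \<in> V"
        using \<U>(4) topspace_B_flex_top by blast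
      moreover have "f ` {0..<card \<U>} = \<U>"
        using f by (rule bij_betw_imp_surj_on)
      ultimately obtain l where "l \<in> {0..<card \<U>}" "b \<in> f l"
        by blast
      then show "b \<in> (\<Union>l<8. U l)"
        using small by (intro UN_I[of l]) (auto simp: U_def)
    qed
    ultimately show False
      using no_eight_sections by blast
  qed
  then show "9 \<le> g"
    by (simp add: \<U>(1) numeral_eq_enat)
qed

end
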